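(* Let a contraction $T=\begin{pmatrix}A&B\\ C&D\end{pmatrix}:\mathfrak H\oplus\mathfrak M\to\mathfrak H\oplus\mathfrak N$ possess the properties $$\left(D_T^2\right)_{\mathfrak H}=0,\quad \left(D_{T^*}^2\right)_{\mathfrak H}=0,\quad \mathrm{ran}\left(\left(D^2_{P_{\mathfrak N}T}\right)_{\mathfrak H}\right)^{1/2}\cap\mathrm{ran}\left(\left(D^2_{P_{\mathfrak M}T^*}\right)_{\mathfrak H}\right)^{1/2}=\{0\}.$$ Then the generalized KYP inequality $$\left\|\begin{pmatrix}X^{1/2}&0\\ 0&I_{\mathfrak M}\end{pmatrix}\begin{pmatrix}x\\ u\end{pmatrix}\right\|^2-\left\|\begin{pmatrix}X^{1/2}&0\\ 0&I_{\mathfrak N}\end{pmatrix}\begin{pmatrix}A&B\\ C&D\end{pmatrix}\begin{pmatrix}x\\ u\end{pmatrix}\right\|^2\ge0\quad\text{for all }x\in\mathrm{dom}\,X^{1/2},\ u\in\mathfrak M$$ has a unique solution $X=I_{\mathfrak H}$.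
   Context: Hilbert spaces are complex and separable. For a contraction $T$, $D_T=(I-T^*T)^{1/2}$. $P_{\mathfrak M}$ is the orthogonal projection onto $\mathfrak M$ in $\mathfrak H\oplus\mathfrak M$, $P_{\mathfrak N}$ that onto $\mathfrak N$ in $\mathfrak H\oplus\mathfrak N$; $D^2_{P_{\mathfrak N}T}=I-T^*P_{\mathfrak N}T$ acts in $\mathfrak H\oplus\mathfrak M$ and $D^2_{P_{\mathfrak M}T^*}=I-TP_{\mathfrak M}T^*$ acts in $\mathfrak H\oplus\mathfrak N$. Shorted operator: for bounded $S\ge0$ in $\mathcal H$ and a closed subspace $\mathcal K$, $S_{\mathcal K}=\max\{Z:\ 0\le Z\le S,\ \mathrm{ran}\,Z\subseteq\mathcal K\}$. The ranges above are regarded as linear manifolds of the same space $\mathfrak H$. Solutions of the generalized KYP inequality are positive selfadjoint operators $X$ in $\mathfrak H$ (nonnegative, $\ker X=\{0\}$, possibly unbounded) such that $A\,\mathrm{dom}\,X^{1/2}\subset\mathrm{dom}\,X^{1/2}$, $\mathrm{ran}\,B\subset\mathrm{dom}\,X^{1/2}$, and the displayed inequality holds. *)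

theory Defs
  imports "HOL-Analysis.Analysis"
begin

section \<open>Complex separable Hilbert spaces\<close>

text \<open>
  The inner product \<open>cinner\<close> is linear in its first argument. The underlying real structure
  (norm, topology, \<open>scaleR\<close>) is the one of the library class \<open>real_inner\<close>: since
  \<open>inner = Re \<circ> cinner\<close>, the library norm satisfies \<open>(norm x)\<^sup>2 = cinner x x\<close>.
  The order on \<open>complex\<close> is that of \<open>HOL-Library.Complex_Order\<close>, so \<open>0 \<le> z\<close> means that
  \<open>z\<close> is real and nonnegative.
\<close>

class complex_hilbert_space = real_inner + complete_space +
  fixes scaleC :: "complex \<Rightarrow> 'a \<Rightarrow> 'a" (infixr "*\<^sub>C" 75)
    and cinner :: "'a \<Rightarrow> 'a \<Rightarrow> complex"
  assumes scaleC_add_right: "c *\<^sub>C (x + y) = c *\<^sub>C x + c *\<^sub>C y"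
    and scaleC_add_left: "(c + d) *\<^sub>C x = c *\<^sub>C x + d *\<^sub>C x"
    and scaleC_scaleC: "c *\<^sub>C d *\<^sub>C x = (c * d) *\<^sub>C x"
    and scaleC_of_real: "complex_of_real r *\<^sub>C x = r *\<^sub>R x"
    and cinner_commute: "cinner x y = cnj (cinner y x)"
    and cinner_add_left: "cinner (x + y) z = cinner x z + cinner y z"
    and cinner_scaleC_left: "cinner (c *\<^sub>C x) y = c * cinner x y"
    and inner_eq_Re_cinner: "inner x y = Re (cinner x y)"

class separable_hilbert_space = complex_hilbert_space + second_countable_topology

lemma cinner_self:
  fixes x :: "'a::complex_hilbert_space"
  shows "cinner x x = complex_of_real ((norm x)\<^sup>2)"
proof (rule complex_eqI)
  show "Re (cinner x x) = Re (complex_of_real ((norm x)\<^sup>2))"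
    by (simp add: power2_norm_eq_inner inner_eq_Re_cinner)
  have "Im (cinner x x) = - Im (cinner x x)"
    using arg_cong[OF cinner_commute[of x x], of Im] by simp
  then show "Im (cinner x x) = Im (complex_of_real ((norm x)\<^sup>2))"
    by simp
qed

text \<open>The orthogonal sum of two Hilbert spaces is the product type, with the library norm.\<close>

instantiation prod :: (complex_hilbert_space, complex_hilbert_space) complex_hilbert_space
begin

definition scaleC_prod :: "complex \<Rightarrow> 'a \<times> 'b \<Rightarrow> 'a \<times> 'b"
  where "scaleC_prod c z = (c *\<^sub>C fst z, c *\<^sub>C snd z)"

definition cinner_prod :: "'a \<times> 'b \<Rightarrow> 'a \<times> 'b \<Rightarrow> complex"
  where "cinner_prod z w = cinner (fst z) (fst w) + cinner (snd z) (snd w)"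

instance
proof
  fix x y z :: "'a \<times> 'b" and c d :: complex and r :: real
  show "c *\<^sub>C (x + y) = c *\<^sub>C x + c *\<^sub>C y"
    by (simp add: scaleC_prod_def scaleC_add_right)
  show "(c + d) *\<^sub>C x = c *\<^sub>C x + d *\<^sub>C x"
    by (simp add: scaleC_prod_def scaleC_add_left)
  show "c *\<^sub>C d *\<^sub>C x = (c * d) *\<^sub>C x"
    by (simp add: scaleC_prod_def scaleC_scaleC)
  show "complex_of_real r *\<^sub>C x = r *\<^sub>R x"
    by (simp add: scaleC_prod_def scaleC_of_real prod_eq_iff)
  show "cinner x y = cnj (cinner y x)"
    by (simp add: cinner_prod_def flip: cinner_commute)
  show "cinner (x + y) z = cinner x z + cinner y z"
    by (simp add: cinner_prod_def cinner_add_left)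
  show "cinner (c *\<^sub>C x) y = c * cinner x y"
    by (simp add: cinner_prod_def scaleC_prod_def cinner_scaleC_left algebra_simps)
  show "inner x y = Re (cinner x y)"
    by (simp add: cinner_prod_def inner_prod_def inner_eq_Re_cinner)
qed

end

instance prod :: (separable_hilbert_space, separable_hilbert_space) separable_hilbert_space ..

definition csubspace :: "'a::complex_hilbert_space set \<Rightarrow> bool"
  where "csubspace K \<longleftrightarrow>
    0 \<in> K \<and> (\<forall>x\<in>K. \<forall>y\<in>K. x + y \<in> K) \<and> (\<forall>c. \<forall>x\<in>K. c *\<^sub>C x \<in> K)"


section \<open>Bounded operators\<close>

definition bounded_clinear ::
    "('a::complex_hilbert_space \<Rightarrow> 'b::complex_hilbert_space) \<Rightarrow> bool"
  where "bounded_clinear T \<longleftrightarrow> bounded_linear T \<and> (\<forall>c x. T (c *\<^sub>C x) = c *\<^sub>C T x)"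

definition contraction ::
    "('a::complex_hilbert_space \<Rightarrow> 'b::complex_hilbert_space) \<Rightarrow> bool"
  where "contraction T \<longleftrightarrow> bounded_clinear T \<and> (\<forall>x. norm (T x) \<le> norm x)"

definition cadjoint ::
    "('a::complex_hilbert_space \<Rightarrow> 'b::complex_hilbert_space) \<Rightarrow> 'b \<Rightarrow> 'a"
  where "cadjoint T = (THE S. \<forall>x y. cinner (T x) y = cinner x (S y))"

definition positive_op :: "('a::complex_hilbert_space \<Rightarrow> 'a) \<Rightarrow> bool"
  where "positive_op S \<longleftrightarrow> bounded_clinear S \<and> (\<forall>x. 0 \<le> cinner (S x) x)"

definition op_le ::
    "('a::complex_hilbert_space \<Rightarrow> 'a) \<Rightarrow> ('a \<Rightarrow> 'a) \<Rightarrow> bool"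
  where "op_le Z S \<longleftrightarrow> positive_op (\<lambda>x. S x - Z x)"

definition sqrt_op :: "('a::complex_hilbert_space \<Rightarrow> 'a) \<Rightarrow> 'a \<Rightarrow> 'a"
  where "sqrt_op S = (THE R. positive_op R \<and> R \<circ> R = S)"

text \<open>The defect operator \<open>D\<^sub>T = (I - T\<^sup>*T)\<^sup>1\<^sup>/\<^sup>2\<close>, and its square.\<close>

definition defect ::
    "('a::complex_hilbert_space \<Rightarrow> 'b::complex_hilbert_space) \<Rightarrow> 'a \<Rightarrow> 'a"
  where "defect T = sqrt_op (\<lambda>x. x - cadjoint T (T x))"

definition defect_sq ::
    "('a::complex_hilbert_space \<Rightarrow> 'b::complex_hilbert_space) \<Rightarrow> 'a \<Rightarrow> 'a"
  where "defect_sq T = defect T \<circ> defect T"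

text \<open>The shorted operator: the greatest element of the set of all \<open>Z\<close> with
  \<open>0 \<le> Z \<le> S\<close> and \<open>ran Z \<subseteq> K\<close> in the operator order.\<close>

definition shorted_candidates ::
    "('a::complex_hilbert_space \<Rightarrow> 'a) \<Rightarrow> 'a set \<Rightarrow> ('a \<Rightarrow> 'a) set"
  where "shorted_candidates S K = {Z. positive_op Z \<and> op_le Z S \<and> range Z \<subseteq> K}"

definition shorted ::
    "('a::complex_hilbert_space \<Rightarrow> 'a) \<Rightarrow> 'a set \<Rightarrow> 'a \<Rightarrow> 'a"
  where "shorted S K = (THE Z. Z \<in> shorted_candidates S K \<and>
    (\<forall>Z'\<in>shorted_candidates S K. op_le Z' Z))"


section \<open>Operators on orthogonal sums\<close>

definition block_op ::
    "('h \<Rightarrow> 'h) \<Rightarrow> ('m \<Rightarrow> 'h) \<Rightarrow> ('h \<Rightarrow> 'n) \<Rightarrow> ('m \<Rightarrow> 'n) \<Rightarrow> 'h \<times> 'm \<Rightarrow>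
      'h::complex_hilbert_space \<times> 'n::complex_hilbert_space"
  where "block_op A B C D = (\<lambda>(x, u). (A x + B u, C x + D u))"

text \<open>The first summand, regarded as a closed subspace of the orthogonal sum, and the orthogonal
  projection onto the second summand.\<close>

definition fst_space :: "('h::complex_hilbert_space \<times> 'm::complex_hilbert_space) set"
  where "fst_space = UNIV \<times> {0}"

definition snd_proj ::
    "'h::complex_hilbert_space \<times> 'm::complex_hilbert_space \<Rightarrow> 'h \<times> 'm"
  where "snd_proj = (\<lambda>(x, u). (0, u))"

text \<open>
  \<open>((D\<^sub>S\<^sup>2)\<^sub>H)\<^sup>1\<^sup>/\<^sup>2\<close> acts in \<open>H \<oplus> M\<close> and its range lies in \<open>H \<oplus> {0}\<close>. Taking first components
  makes it a linear manifold of \<open>H\<close>, so that such ranges can be compared for different \<open>M\<close>.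
\<close>

definition short_defect_range ::
    "('h::complex_hilbert_space \<times> 'm::complex_hilbert_space \<Rightarrow> 'k::complex_hilbert_space)
      \<Rightarrow> 'h set"
  where "short_defect_range S = fst ` range (sqrt_op (shorted (defect_sq S) fst_space))"


section \<open>Unbounded operators\<close>

text \<open>
  A possibly unbounded operator is a partial function \<open>X\<close> with domain \<open>dom X\<close>. The identity
  operator, with domain the whole space, is \<open>Some\<close>.
\<close>

definition linear_operator :: "('a::complex_hilbert_space \<rightharpoonup> 'a) \<Rightarrow> bool"
  where "linear_operator X \<longleftrightarrow> csubspace (Map.graph X)"

text \<open>The second conjunct is density of the domain; the third one says that \<open>X = X\<^sup>*\<close>, domains
  included: \<open>y \<in> dom X\<^sup>*\<close> with \<open>X\<^sup>* y = z\<close> iff \<open>cinner (X x) y = cinner x z\<close> for all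
  \<open>x \<in> dom X\<close>.\<close>

definition selfadjoint :: "('a::complex_hilbert_space \<rightharpoonup> 'a) \<Rightarrow> bool"
  where "selfadjoint X \<longleftrightarrow> linear_operator X \<and> closure (dom X) = UNIV \<and>
    (\<forall>y z. X y = Some z \<longleftrightarrow> (\<forall>x\<in>dom X. cinner (the (X x)) y = cinner x z))"

definition nonneg_selfadjoint :: "('a::complex_hilbert_space \<rightharpoonup> 'a) \<Rightarrow> bool"
  where "nonneg_selfadjoint X \<longleftrightarrow>
    selfadjoint X \<and> (\<forall>x\<in>dom X. 0 \<le> cinner (the (X x)) x)"

definition positive_selfadjoint :: "('a::complex_hilbert_space \<rightharpoonup> 'a) \<Rightarrow> bool"
  where "positive_selfadjoint X \<longleftrightarrow> nonneg_selfadjoint X \<and> {x. X x = Some 0} = {0}"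

text \<open>The nonnegative selfadjoint square root; the composition has its natural domain.\<close>

definition sqrt_operator :: "('a::complex_hilbert_space \<rightharpoonup> 'a) \<Rightarrow> ('a \<rightharpoonup> 'a)"
  where "sqrt_operator X = (THE R. nonneg_selfadjoint R \<and> R \<circ>\<^sub>m R = X)"

text \<open>The action of the block diagonal operator \<open>diag(R, I)\<close>; meaningful at \<open>(x, u)\<close> with
  \<open>x \<in> dom R\<close>.\<close>

definition diag_id ::
    "('h::complex_hilbert_space \<rightharpoonup> 'h) \<Rightarrow> 'h \<times> 'm::complex_hilbert_space \<Rightarrow> 'h \<times> 'm"
  where "diag_id R = (\<lambda>(x, u). (the (R x), u))"

definition kyp_solution ::
    "('h::complex_hilbert_space \<Rightarrow> 'h) \<Rightarrow> ('m::complex_hilbert_space \<Rightarrow> 'h) \<Rightarrow>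
      ('h \<Rightarrow> 'n::complex_hilbert_space) \<Rightarrow> ('m \<Rightarrow> 'n) \<Rightarrow> ('h \<rightharpoonup> 'h) \<Rightarrow> bool"
  where "kyp_solution A B C D X \<longleftrightarrow>
    positive_selfadjoint X \<and>
    A ` dom (sqrt_operator X) \<subseteq> dom (sqrt_operator X) \<and>
    range B \<subseteq> dom (sqrt_operator X) \<and>
    (\<forall>x\<in>dom (sqrt_operator X). \<forall>u.
      (norm (diag_id (sqrt_operator X) (x, u)))\<^sup>2
        - (norm (diag_id (sqrt_operator X) (block_op A B C D (x, u))))\<^sup>2 \<ge> 0)"

end

(*
  A storage function phi (phi >= 0 and phi(A x + B u) + |C x + D u|^2 <= phi(x) + |u|^2) satisfies
  |x|^2 - phi(x) <= |D_T (x,u)|^2 + |y|^2 + |v|^2 - |C y + D v|^2 for all u, v, where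
  y = A x + B u. The infimum of the right-hand side over u, v is zero because, with S = P_N T, every
  (a,b) orthogonal to all (D_T (0,u), D_S (B u,v)) is orthogonal to (D_T (x,0), D_S (A x,0)):
  orthogonality gives D_S b = (g,0) and D_T a + T^* (g,0) = (e,0), so that
  (g,0) = T(e,0) - T D_T a + D_{T^*}^2 (g,0), and g lies in both ranges of the third hypothesis.
  Hence g = 0, and then D_T a = (e,0) = 0 by the first hypothesis.
  Therefore phi(x) >= |x|^2. For a solution X = R^2 this applies to phi(x) = |R x|^2 and, by duality,
  to T^* with phi(R y) = |y|^2. Hence R is isometric on its domain, and X = I.
*)

theory Submission
  imports Defs
begin

section \<open>The Riesz representation theorem\<close>

text \<open>The first hypothesis alone makes \<open>|D_T (x,u)|\<close> small for suitable
  \<open>u\<close>, but this only bounds \<open>|x|^2 - phi(x)\<close> by the same quantity at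
  \<open>y\<close>. The second step breaks the circle, because there only \<open>phi >= 0\<close> is
  kept after the output. The price is that one \<open>u\<close> has to make two defects small at
  once, and the infimum need not be attained; hence the orthogonality argument against the closure
  of a linear manifold. Membership of \<open>g\<close> in the range belonging to
  \<open>P_M T^*\<close> comes without a visible preimage. It rests on Douglas' criterion: the
  functional \<open>inner (g,0)\<close> is dominated by \<open>|D_{P_M T^*} z|\<close>.
  \<open>sqrt_op\<close>, \<open>shorted\<close> and \<open>sqrt_operator\<close> are definite
  descriptions, so existence and uniqueness of each object must be established. The unbounded root
  is reduced to bounded operators through the resolvent \<open>(I + X)^{-1}\<close>, in place of the
  spectral theorem.\<close>

lemma quadratic_nonneg_imp_zero:
  fixes b c :: real
  assumes "\<And>s. 0 \<le> 2 * s * b + s\<^sup>2 * c"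
  shows "b = 0"
proof (rule ccontr)
  assume b: "b \<noteq> 0"
  have c: "c \<ge> 0"
    using assms[of 1] assms[of "-1"] by simp
  \<comment> \<open>The denominator \<open>c + 1\<close> stays positive when \<open>c = 0\<close>,
    and the quadratic is still negative at this \<open>s\<close>.\<close>
  define s where "s = - b / (c + 1)"
  have b_eq: "b = - s * (c + 1)" and "s \<noteq> 0"
    using b c by (simp_all add: s_def)
  have "2 * s * b + s\<^sup>2 * c = - (s\<^sup>2 * (c + 2))"
    unfolding b_eq by (simp add: power2_eq_square algebra_simps)
  moreover have "s\<^sup>2 * (c + 2) > 0"
    using c \<open>s \<noteq> 0\<close> by simp
  ultimately show False
    using assms[of s] by linarith
qed

text \<open>The functional \<open>l \<mapsto> t\<close> is given by its graph \<open>W\<close>. Applied to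
  \<open>{(L x, f x) | x \<in> V}\<close>, this covers functionals that are bounded by a seminorm \<open>norm (L x)\<close>,
  and orthogonal projections onto \<open>closure (L ` V)\<close>.\<close>

lemma riesz_graph:
  fixes W :: "('b::{real_inner,complete_space} \<times> real) set"
  assumes W: "subspace W" and bound: "\<And>l t. (l, t) \<in> W \<Longrightarrow> \<bar>t\<bar> \<le> c * norm l" and "c \<ge> 0"
  shows "\<exists>v \<in> closure (fst ` W). norm v \<le> c \<and> (\<forall>(l, t) \<in> W. t = inner l v)"
proof -
  \<comment> \<open>\<open>J\<close> is the graph form of \<open>|l|^2 - 2 f(l)\<close>. For
    \<open>f(l) = inner l v\<close> it equals \<open>|l - v|^2 - |v|^2\<close>, so a minimising
    sequence should converge to the representing vector.\<close>
  define J where "J p = (norm (fst p))\<^sup>2 - 2 * snd p" for p :: "'b \<times> real"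
  have J_ge: "J p \<ge> - (c\<^sup>2)" if "p \<in> W" for p
  proof -
    have "snd p \<le> c * norm (fst p)"
      using bound[of "fst p" "snd p"] that by simp
    moreover have "0 \<le> (norm (fst p) - c)\<^sup>2"
      by simp
    ultimately show ?thesis
      by (simp add: J_def power2_diff algebra_simps)
  qed
  define m where "m = Inf (J ` W)"
  have bdd: "bdd_below (J ` W)"
    using J_ge by (intro bdd_belowI2)
  have m_le: "m \<le> J p" if "p \<in> W" for p
    unfolding m_def using bdd that by (simp add: cInf_lower)
  have "W \<noteq> {}"
    using W subspace_0 by blast
  have "\<exists>p\<in>W. J p < m + 1 / real (Suc n)" for n
  proof -
    have "m < m + 1 / real (Suc n)"
      by simp
    then show ?thesis
      using \<open>W \<noteq> {}\<close> bdd unfolding m_def by (subst (asm) cInf_less_iff) auto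
  qed
  then obtain p where p: "p n \<in> W" "J (p n) < m + 1 / real (Suc n)" for n
    by metis
  define l where "l n = fst (p n)" for n
  have diff: "(norm (l i - l j))\<^sup>2 \<le> 2 / real (Suc i) + 2 / real (Suc j)" for i j
  proof -
    \<comment> \<open>The midpoint stays in \<open>W\<close>; the parallelogram law turns
      near-minimality of \<open>J\<close> into closeness of \<open>l i\<close> and
      \<open>l j\<close>.\<close>
    define q where "q = (1/2) *\<^sub>R (p i + p j)"
    have "q \<in> W"
      unfolding q_def using W p by (intro subspace_scale subspace_add)
    then have "m \<le> J q"
      by (rule m_le)
    moreover have "J (p i) + J (p j) - 2 * J q = (norm (l i - l j))\<^sup>2 / 2"
      by (simp add: J_def q_def l_def power2_norm_eq_inner inner_add inner_diff inner_commute
          field_simps)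
    ultimately show ?thesis
      using p(2)[of i] p(2)[of j] by linarith
  qed
  have "Cauchy l"
  proof (rule metric_CauchyI)
    fix e :: real
    assume e: "e > 0"
    obtain M where M: "1 / real (Suc M) < e\<^sup>2 / 4"
      using reals_Archimedean[of "e\<^sup>2 / 4"] e by (auto simp: inverse_eq_divide)
    have "dist (l i) (l j) < e" if "i \<ge> M" "j \<ge> M" for i j
    proof -
      have "1 / real (Suc i) \<le> 1 / real (Suc M)" "1 / real (Suc j) \<le> 1 / real (Suc M)"
        using that by (simp_all add: frac_le)
      then have "(norm (l i - l j))\<^sup>2 < e\<^sup>2"
        using diff[of i j] M by simp
      then show ?thesis
        using e by (simp add: dist_norm power2_less_imp_less)
    qed
    then show "\<exists>M. \<forall>i\<ge>M. \<forall>j\<ge>M. dist (l i) (l j) < e"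
      by blast
  qed
  then obtain v where v: "l \<longlonglongrightarrow> v"
    using Cauchy_convergent convergent_def by blast
  have v_closure: "v \<in> closure (fst ` W)"
    using v p(1) unfolding closure_sequential l_def by (intro exI[of _ "\<lambda>n. fst (p n)"]) simp
  have J_lim: "(\<lambda>n. J (p n)) \<longlonglongrightarrow> m"
  proof (rule tendsto_sandwich)
    show "\<forall>\<^sub>F n in sequentially. m \<le> J (p n)"
      using m_le p by simp
    show "\<forall>\<^sub>F n in sequentially. J (p n) \<le> m + 1 / real (Suc n)"
      using p(2) by (simp add: less_imp_le)
    show "(\<lambda>n. m + 1 / real (Suc n)) \<longlonglongrightarrow> m"
      using tendsto_add[OF tendsto_const LIMSEQ_inverse_real_of_nat] by (simp add: inverse_eq_divide)
  qed simp
  have repr: "t = inner k v" if "(k, t) \<in> W" for k t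
  proof -
    \<comment> \<open>First-order condition: \<open>p n\<close> is moved along the direction
      \<open>(k, t)\<close>, and in the limit \<open>m\<close> cancels from both sides.\<close>
    have "0 \<le> 2 * s * (inner v k - t) + s\<^sup>2 * (norm k)\<^sup>2" for s
    proof -
      have "m \<le> J (p n) + 2 * s * (inner (l n) k - t) + s\<^sup>2 * (norm k)\<^sup>2" for n
      proof -
        have "p n + s *\<^sub>R (k, t) \<in> W"
          using W p that by (intro subspace_scale subspace_add)
        then have "m \<le> J (p n + s *\<^sub>R (k, t))"
          by (rule m_le)
        also have "\<dots> = J (p n) + 2 * s * (inner (l n) k - t) + s\<^sup>2 * (norm k)\<^sup>2"
          by (simp add: J_def l_def power2_norm_eq_inner inner_add inner_commute algebra_simps)
             (simp add: power2_eq_square)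
        finally show ?thesis .
      qed
      moreover have "(\<lambda>n. J (p n) + 2 * s * (inner (l n) k - t) + s\<^sup>2 * (norm k)\<^sup>2)
          \<longlonglongrightarrow> m + 2 * s * (inner v k - t) + s\<^sup>2 * (norm k)\<^sup>2"
        by (intro tendsto_intros J_lim v)
      ultimately have "m \<le> m + 2 * s * (inner v k - t) + s\<^sup>2 * (norm k)\<^sup>2"
        by (intro LIMSEQ_le_const) auto
      then show ?thesis
        by simp
    qed
    then have "inner v k - t = 0"
      by (rule quadratic_nonneg_imp_zero)
    then show ?thesis
      by (simp add: inner_commute)
  qed
  \<comment> \<open>The bound on \<open>W\<close>, tested at \<open>l n\<close> itself, becomes
    \<open>|v|^2 <= c |v|\<close> in the limit.\<close>
  have "norm v \<le> c"
  proof -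
    have "inner (l n) v \<le> c * norm (l n)" for n
    proof -
      have "(l n, snd (p n)) \<in> W"
        using p(1)[of n] by (simp add: l_def)
      then show ?thesis
        using repr bound by (metis abs_le_D1)
    qed
    moreover have "(\<lambda>n. inner (l n) v) \<longlonglongrightarrow> inner v v" "(\<lambda>n. c * norm (l n)) \<longlonglongrightarrow> c * norm v"
      by (intro tendsto_intros v)+
    ultimately have "inner v v \<le> c * norm v"
      by (intro LIMSEQ_le) auto
    then have "norm v * norm v \<le> c * norm v"
      by (simp add: power2_norm_eq_inner flip: power2_eq_square)
    then show ?thesis
      using \<open>c \<ge> 0\<close> by (cases "v = 0") auto
  qed
  then show ?thesis
    using v_closure repr by blast
qed

text \<open>The projection of \<open>y\<close> is the Riesz vector of the functional
  \<open>inner _ y\<close> on \<open>V\<close>. Below, \<open>V\<close> is mostly a range or another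
  linear manifold, hence the closure in the conclusion.\<close>

lemma orthogonal_projection_exists:
  fixes V :: "'a::{real_inner,complete_space} set"
  assumes "subspace V"
  shows "\<exists>v \<in> closure V. \<forall>x\<in>V. inner x (y - v) = 0"
proof -
  define W where "W = (\<lambda>x. (x, inner x y)) ` V"
  have "linear (\<lambda>x. (x, inner x y))"
    by (intro linearI) (simp_all add: inner_add_left)
  then have "subspace W"
    unfolding W_def by (rule linear_subspace_image[OF _ assms])
  then have "\<exists>v \<in> closure (fst ` W). norm v \<le> norm y \<and> (\<forall>(l, t) \<in> W. t = inner l v)"
    by (rule riesz_graph)
       (use Cauchy_Schwarz_ineq2[of _ y] in \<open>auto simp: W_def mult.commute\<close>)
  moreover have "fst ` W = V"
    by (force simp: W_def)
  ultimately show ?thesis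
    by (auto simp: W_def inner_diff_right)
qed

lemma eq_zero_if_inner_zero:
  fixes z :: "'a::real_inner"
  shows "(\<And>x. inner x z = 0) \<Longrightarrow> z = 0"
  by (metis inner_eq_zero_iff)

lemma eq_if_inner_eq:
  fixes y z :: "'a::real_inner"
  assumes "\<And>x. inner x y = inner x z"
  shows "y = z"
  using eq_zero_if_inner_zero[of "y - z"] assms by (simp add: inner_diff_right)

section \<open>Complex inner products and bounded operators\<close>

text \<open>Conjugate linearity in the second argument makes multiplication by \<open>\<i>\<close>
  skew for the real inner product. Together with \<open>Im_cinner\<close> this lets adjoints,
  positivity and selfadjointness be treated through the real \<open>inner\<close>.\<close>

lemma inner_scaleC_i: "inner (\<i> *\<^sub>C x) y = - inner x (\<i> *\<^sub>C (y::'a::complex_hilbert_space))"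
proof -
  have "cinner x (\<i> *\<^sub>C y) = cnj (\<i> * cinner y x)"
    by (metis cinner_commute cinner_scaleC_left)
  also have "\<dots> = - \<i> * cinner x y"
    by (metis cinner_commute complex_cnj_i complex_cnj_mult)
  finally show ?thesis
    by (simp add: inner_eq_Re_cinner cinner_scaleC_left)
qed

lemma Im_cinner: "Im (cinner x y) = inner x (\<i> *\<^sub>C (y::'a::complex_hilbert_space))"
proof -
  have "Im (cinner x y) = - inner (\<i> *\<^sub>C x) y"
    by (simp add: inner_eq_Re_cinner cinner_scaleC_left)
  then show ?thesis
    by (simp add: inner_scaleC_i)
qed

lemma scaleC_i_i [simp]: "\<i> *\<^sub>C \<i> *\<^sub>C (x::'a::complex_hilbert_space) = - x"
  using scaleC_scaleC[of \<i> \<i> x] scaleC_of_real[of "-1" x] by simp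

lemma scaleC_eq: "c *\<^sub>C (x::'a::complex_hilbert_space) = Re c *\<^sub>R x + Im c *\<^sub>R \<i> *\<^sub>C x"
proof -
  have "c = complex_of_real (Re c) + complex_of_real (Im c) * \<i>"
    by (metis complex_eq mult.commute)
  then have "c *\<^sub>C x = complex_of_real (Re c) *\<^sub>C x + (complex_of_real (Im c) * \<i>) *\<^sub>C x"
    by (metis scaleC_add_left)
  then show ?thesis
    by (simp add: scaleC_of_real flip: scaleC_scaleC)
qed

lemma bounded_clinear_bounded_linear: "bounded_clinear T \<Longrightarrow> bounded_linear T"
  by (simp add: bounded_clinear_def)

lemma bounded_clinear_linear: "bounded_clinear T \<Longrightarrow> linear T"
  by (simp add: bounded_clinear_def bounded_linear.linear)

lemma bounded_clinear_scaleC: "bounded_clinear T \<Longrightarrow> T (c *\<^sub>C x) = c *\<^sub>C T x"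
  by (simp add: bounded_clinear_def)

text \<open>A complex multiple of \<open>x\<close> is a real combination of \<open>x\<close> and its
  multiple by \<open>\<i>\<close>, so real linearity leaves only \<open>\<i>\<close> to
  check.\<close>

lemma bounded_clinearI:
  assumes "bounded_linear T" and "\<And>x. T (\<i> *\<^sub>C x) = \<i> *\<^sub>C T x"
  shows "bounded_clinear T"
  unfolding bounded_clinear_def
proof (intro conjI allI)
  interpret bounded_linear T by fact
  fix c x
  show "T (c *\<^sub>C x) = c *\<^sub>C T x"
    by (simp add: scaleC_eq[of c] add scaleR assms(2))
qed (fact assms(1))

lemma scaleC_diff_right: "c *\<^sub>C (x - y) = c *\<^sub>C x - c *\<^sub>C (y::'a::complex_hilbert_space)"
  by (metis add_diff_cancel_right' diff_add_cancel scaleC_add_right)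

lemma scaleC_scaleR_commute: "c *\<^sub>C r *\<^sub>R x = r *\<^sub>R c *\<^sub>C (x::'a::complex_hilbert_space)"
  by (simp add: scaleC_scaleC mult.commute flip: scaleC_of_real)

lemma bounded_clinear_ident: "bounded_clinear (\<lambda>x. x)"
  by (intro bounded_clinearI bounded_linear_ident) simp

lemma bounded_clinear_zero: "bounded_clinear (\<lambda>x. 0)"
  by (intro bounded_clinearI bounded_linear_zero)
     (metis scaleC_add_right add_cancel_right_right add.right_neutral)

lemma bounded_clinear_compose:
  "bounded_clinear f \<Longrightarrow> bounded_clinear g \<Longrightarrow> bounded_clinear (\<lambda>x. f (g x))"
  unfolding bounded_clinear_def by (auto intro: bounded_linear_compose)

lemma bounded_clinear_add:
  "bounded_clinear f \<Longrightarrow> bounded_clinear g \<Longrightarrow> bounded_clinear (\<lambda>x. f x + g x)"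
  unfolding bounded_clinear_def by (auto intro: bounded_linear_add simp: scaleC_add_right)

lemma bounded_clinear_diff:
  "bounded_clinear f \<Longrightarrow> bounded_clinear g \<Longrightarrow> bounded_clinear (\<lambda>x. f x - g x)"
  unfolding bounded_clinear_def by (auto intro: bounded_linear_sub simp: scaleC_diff_right)

lemma bounded_clinear_scaleR:
  "bounded_clinear f \<Longrightarrow> bounded_clinear (\<lambda>x. r *\<^sub>R f x)"
  unfolding bounded_clinear_def
  by (auto intro: bounded_linear_compose[OF bounded_linear_scaleR_right]
      simp: scaleC_scaleR_commute)

lemmas bounded_clinear_intros = bounded_clinear_ident bounded_clinear_zero
  bounded_clinear_add bounded_clinear_diff bounded_clinear_scaleR

lemma bounded_clinear_norm_bound:
  assumes "bounded_clinear T"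
  obtains K where "K > 0" and "\<And>x. norm (T x) \<le> K * norm x"
  using bounded_linear.pos_bounded[OF bounded_clinear_bounded_linear[OF assms]]
  by (metis mult.commute)


section \<open>Adjoints\<close>

text \<open>Inserting \<open>\<i>\<close> times \<open>x\<close> into the real identity gives the
  imaginary part of the complex one. \<open>S\<close> is an arbitrary function here; its linearity
  is derived afterwards in \<open>bounded_clinear_adjointI\<close>.\<close>

lemma cinner_adjoint_iff:
  assumes "bounded_clinear T"
  shows "(\<forall>x y. cinner (T x) y = cinner x (S y)) \<longleftrightarrow> (\<forall>x y. inner (T x) y = inner x (S y))"
proof safe
  fix x y
  assume *: "\<forall>x y. inner (T x) y = inner x (S y)"
  have "inner (T x) (\<i> *\<^sub>C y) = inner x (\<i> *\<^sub>C S y)"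
    using *[rule_format, of "\<i> *\<^sub>C x" y]
    by (simp add: bounded_clinear_scaleC[OF assms] inner_scaleC_i)
  then show "cinner (T x) y = cinner x (S y)"
    using * by (intro complex_eqI) (simp_all add: Im_cinner flip: inner_eq_Re_cinner)
qed (simp add: inner_eq_Re_cinner)

lemma cadjoint_eqI:
  assumes T: "bounded_clinear T" and adj: "\<And>x y. inner (T x) y = inner x (S y)"
  shows "cadjoint T = S"
  unfolding cadjoint_def
proof (rule the_equality)
  show "\<forall>x y. cinner (T x) y = cinner x (S y)"
    using cinner_adjoint_iff[OF T, of S] adj by blast
  fix S'
  assume S': "\<forall>x y. cinner (T x) y = cinner x (S' y)"
  have "inner x (S' y) = inner x (S y)" for x y
  proof -
    have "inner (T x) y = inner x (S' y)"
      using cinner_adjoint_iff[OF T, of S'] S' by blast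
    then show ?thesis
      by (simp only: adj)
  qed
  then show "S' = S"
    using eq_if_inner_eq by blast
qed

lemma bounded_clinear_adjointI:
  assumes T: "bounded_clinear T" and adj: "\<And>x y. inner (T x) y = inner x (S y)"
  shows "bounded_clinear S"
proof -
  obtain K where K: "K > 0" "\<And>x. norm (T x) \<le> K * norm x"
    using bounded_clinear_norm_bound[OF T] by blast
  show ?thesis
  proof (intro bounded_clinearI bounded_linear_intro)
    show "S (x + y) = S x + S y" for x y
      by (rule eq_if_inner_eq) (simp add: inner_add_right flip: adj)
    show "S (r *\<^sub>R x) = r *\<^sub>R S x" for r x
      by (rule eq_if_inner_eq) (simp flip: adj)
    show "norm (S x) \<le> norm x * K" for x
    proof -
      have "norm (S x) * norm (S x) = inner (T (S x)) x"
        by (simp add: adj power2_norm_eq_inner flip: power2_eq_square)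
      also have "\<dots> \<le> norm (T (S x)) * norm x"
        by (rule norm_cauchy_schwarz)
      also have "\<dots> \<le> K * norm (S x) * norm x"
        by (intro mult_right_mono K) simp
      finally show ?thesis
        using K(1) by (cases "S x = 0") (auto simp: mult_ac)
    qed
    show "S (\<i> *\<^sub>C x) = \<i> *\<^sub>C S x" for x
    proof (rule eq_if_inner_eq)
      fix y
      have "inner y (S (\<i> *\<^sub>C x)) = inner (T y) (\<i> *\<^sub>C x)"
        by (rule adj[symmetric])
      also have "\<dots> = - inner (T (\<i> *\<^sub>C y)) x"
        by (simp only: bounded_clinear_scaleC[OF T] inner_scaleC_i minus_minus)
      also have "\<dots> = inner y (\<i> *\<^sub>C S x)"
        by (simp only: adj inner_scaleC_i minus_minus)
      finally show "inner y (S (\<i> *\<^sub>C x)) = inner y (\<i> *\<^sub>C S x)" .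
    qed
  qed
qed

lemma adjoint_exists:
  assumes T: "bounded_clinear T"
  shows "\<exists>S. \<forall>x y. inner (T x) y = inner x (S y)"
proof -
  interpret bounded_linear T
    using T by (rule bounded_clinear_bounded_linear)
  have "\<exists>v. \<forall>x. inner (T x) y = inner x v" for y
  proof -
    obtain K where K: "K > 0" "\<And>x. norm (T x) \<le> K * norm x"
      using bounded_clinear_norm_bound[OF T] by blast
    define W where "W = range (\<lambda>x. (x, inner (T x) y))"
    have "linear (\<lambda>x. (x, inner (T x) y))"
      by (intro linearI) (simp_all add: add scaleR inner_add_left)
    then have "subspace W"
      unfolding W_def by (rule linear_subspace_image) simp
    moreover have "\<bar>t\<bar> \<le> (K * norm y) * norm l" if "(l, t) \<in> W" for l t
    proof -
      have "\<bar>t\<bar> \<le> norm (T l) * norm y"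
        using that Cauchy_Schwarz_ineq2[of "T l" y] by (auto simp: W_def)
      also have "\<dots> \<le> (K * norm l) * norm y"
        by (intro mult_right_mono K) simp
      finally show ?thesis
        by (simp add: mult_ac)
    qed
    ultimately have "\<exists>v \<in> closure (fst ` W). norm v \<le> K * norm y \<and> (\<forall>(l, t) \<in> W. t = inner l v)"
      by (rule riesz_graph) (use K(1) in auto)
    then show ?thesis
      by (auto simp: W_def)
  qed
  then show ?thesis
    by metis
qed

lemma inner_cadjoint:
  assumes "bounded_clinear T"
  shows "inner (T x) y = inner x (cadjoint T y)"
  using adjoint_exists[OF assms] cadjoint_eqI[OF assms] by metis

lemma bounded_clinear_cadjoint: "bounded_clinear T \<Longrightarrow> bounded_clinear (cadjoint T)"
  using bounded_clinear_adjointI inner_cadjoint by blast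

lemma cadjoint_cadjoint: "bounded_clinear T \<Longrightarrow> cadjoint (cadjoint T) = T"
  using cadjoint_eqI[OF bounded_clinear_cadjoint] inner_cadjoint by (metis inner_commute)

lemma contraction_bounded_clinear: "contraction T \<Longrightarrow> bounded_clinear T"
  by (simp add: contraction_def)

lemma contraction_norm_le: "contraction T \<Longrightarrow> norm (T x) \<le> norm x"
  by (simp only: contraction_def)

lemma contraction_cadjoint:
  assumes "contraction T"
  shows "contraction (cadjoint T)"
proof -
  note T = contraction_bounded_clinear[OF assms] and le = contraction_norm_le[OF assms]
  have "norm (cadjoint T y) \<le> norm y" for y
  proof -
    have "norm (cadjoint T y) * norm (cadjoint T y) = inner (T (cadjoint T y)) y"
      by (simp add: inner_cadjoint[OF T] power2_norm_eq_inner flip: power2_eq_square)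
    also have "\<dots> \<le> norm (T (cadjoint T y)) * norm y"
      by (rule norm_cauchy_schwarz)
    also have "\<dots> \<le> norm (cadjoint T y) * norm y"
      by (intro mult_right_mono le) simp
    finally show ?thesis
      by (cases "cadjoint T y = 0") auto
  qed
  then show ?thesis
    using bounded_clinear_cadjoint[OF T] by (simp add: contraction_def)
qed


section \<open>Positive operators\<close>

text \<open>Nonnegativity makes the imaginary part of \<open>cinner (S x) x\<close> vanish;
  polarisation, with \<open>y\<close> multiplied by \<open>\<i>\<close>, turns this into
  symmetry.\<close>

lemma positive_op_iff:
  "positive_op S \<longleftrightarrow> bounded_clinear S \<and> (\<forall>x y. inner (S x) y = inner x (S y)) \<and>
    (\<forall>x. 0 \<le> inner (S x) x)"
  (is "_ \<longleftrightarrow> ?R")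
proof
  assume S: "positive_op S"
  then have bc: "bounded_clinear S" and nn: "\<And>x. 0 \<le> cinner (S x) x"
    by (simp_all add: positive_op_def)
  interpret bounded_linear S
    using bc by (rule bounded_clinear_bounded_linear)
  have Im0: "inner (S x) (\<i> *\<^sub>C x) = 0" for x
    using nn[of x] by (simp add: less_eq_complex_def flip: Im_cinner)
  have polar: "inner (S x) (\<i> *\<^sub>C y) = - inner (S y) (\<i> *\<^sub>C x)" for x y
    using Im0[of "x + y"] Im0[of x] Im0[of y]
    by (simp add: add inner_add_left inner_add_right scaleC_add_right)
  have "inner (S x) y = inner x (S y)" for x y
  proof -
    have "inner (S x) (\<i> *\<^sub>C \<i> *\<^sub>C y) = - inner (S (\<i> *\<^sub>C y)) (\<i> *\<^sub>C x)"
      by (rule polar)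
    also have "\<dots> = inner (S y) (\<i> *\<^sub>C \<i> *\<^sub>C x)"
      by (simp only: bounded_clinear_scaleC[OF bc] inner_scaleC_i minus_minus)
    finally show ?thesis
      by (simp add: inner_commute)
  qed
  moreover have "0 \<le> inner (S x) x" for x
    using nn[of x] by (simp add: less_eq_complex_def inner_eq_Re_cinner)
  ultimately show ?R
    using bc by blast
next
  assume R: ?R
  have Im0: "inner (S x) (\<i> *\<^sub>C x) = 0" for x
  proof -
    have "inner (S x) (\<i> *\<^sub>C x) = inner x (S (\<i> *\<^sub>C x))"
      using R by blast
    also have "\<dots> = - inner (\<i> *\<^sub>C x) (S x)"
      using R by (simp add: bounded_clinear_scaleC inner_scaleC_i)
    finally show ?thesis
      by (simp add: inner_commute)
  qed
  show "positive_op S"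
    using R unfolding positive_op_def less_eq_complex_def Im_cinner Im0
    by (simp add: inner_commute flip: inner_eq_Re_cinner)
qed

lemma positive_opI:
  assumes "bounded_clinear S" "\<And>x y. inner (S x) y = inner x (S y)" "\<And>x. 0 \<le> inner (S x) x"
  shows "positive_op S"
  using assms positive_op_iff by blast

lemma positive_op_bounded: "positive_op S \<Longrightarrow> bounded_clinear S"
  by (simp add: positive_op_def)

lemma positive_op_bounded_linear: "positive_op S \<Longrightarrow> bounded_linear S"
  by (simp add: positive_op_bounded bounded_clinear_bounded_linear)

lemma positive_op_sym: "positive_op S \<Longrightarrow> inner (S x) y = inner x (S y)"
  using positive_op_iff by blast

lemma positive_op_nonneg: "positive_op S \<Longrightarrow> 0 \<le> inner (S x) x"
  using positive_op_iff by blast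

lemma positive_op_Cauchy_Schwarz:
  assumes "positive_op S"
  shows "(inner (S x) y)\<^sup>2 \<le> inner (S x) x * inner (S y) y"
proof -
  interpret bounded_linear S
    using assms by (rule positive_op_bounded_linear)
  define a b c where "a = inner (S x) x" and "b = inner (S x) y" and "c = inner (S y) y"
  have *: "0 \<le> a + 2 * s * b + s\<^sup>2 * c" for s
  proof -
    have "inner (S y) x = b"
      by (metis b_def assms inner_commute positive_op_sym)
    then show ?thesis
      using positive_op_nonneg[OF assms, of "x + s *\<^sub>R y"]
      by (simp add: add scaleR inner_add a_def b_def c_def power2_eq_square algebra_simps)
  qed
  have "b\<^sup>2 \<le> a * c"
  proof (cases "c = 0")
    case True
    have "b = 0"
    proof (rule ccontr)
      assume "b \<noteq> 0"
      \<comment> \<open>With \<open>c = 0\<close> the quadratic is affine in \<open>s\<close>, and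
        this \<open>s\<close> gives it the value \<open>-1\<close>.\<close>
      then show False
        using *[of "- (a + 1) / (2 * b)"] True by (simp add: field_simps)
    qed
    then show ?thesis
      using True by simp
  next
    case False
    then have "c > 0"
      using positive_op_nonneg[OF assms, of y] by (simp add: c_def)
    then show ?thesis
      using *[of "- b / c"] by (simp add: field_simps power2_eq_square)
  qed
  then show ?thesis
    by (simp add: a_def b_def c_def)
qed

lemma positive_op_zero:
  assumes "positive_op S" "inner (S x) x = 0"
  shows "S x = 0"
  using positive_op_Cauchy_Schwarz[OF assms(1), of x "S x"] assms(2) by simp

lemma positive_op_antisym:
  assumes "op_le Z Z'" "op_le Z' Z"
  shows "Z = Z'"
proof
  fix x
  have "0 \<le> inner (Z' x - Z x) x" "0 \<le> inner (Z x - Z' x) x"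
    using assms positive_op_nonneg unfolding op_le_def by blast+
  then have "inner (Z' x - Z x) x = 0"
    by (simp add: inner_diff_left)
  then show "Z x = Z' x"
    using positive_op_zero[of "\<lambda>x. Z' x - Z x" x] assms(1) by (simp add: op_le_def)
qed

text \<open>Cauchy-Schwarz for the form of \<open>S\<close> at \<open>x\<close> and
  \<open>S x\<close> gives \<open>|S x|^4 <= |x|^2 |S x|^2\<close>.\<close>

lemma positive_op_norm_le:
  assumes "positive_op S" "\<And>x. inner (S x) x \<le> (norm x)\<^sup>2"
  shows "norm (S x) \<le> norm x"
proof -
  have "((norm (S x))\<^sup>2)\<^sup>2 \<le> inner (S x) x * inner (S (S x)) (S x)"
    using positive_op_Cauchy_Schwarz[OF assms(1), of x "S x"] by (simp add: power2_norm_eq_inner)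
  also have "\<dots> \<le> (norm x)\<^sup>2 * (norm (S x))\<^sup>2"
    by (intro mult_mono assms(2) positive_op_nonneg assms(1)) simp
  finally have "(norm (S x))\<^sup>2 * (norm (S x))\<^sup>2 \<le> (norm x)\<^sup>2 * (norm (S x))\<^sup>2"
    by (simp only: power2_eq_square)
  then have "(norm (S x))\<^sup>2 \<le> (norm x)\<^sup>2" if "S x \<noteq> 0"
    by (rule mult_right_le_imp_le) (use that in simp)
  then show ?thesis
    using power2_le_imp_le[of "norm (S x)" "norm x"] by (cases "S x = 0") simp_all
qed


section \<open>Square roots of positive operators\<close>

text \<open>\<open>nonneg_comb B c U\<close>: \<open>U = p(B)\<close> for a polynomial \<open>p\<close> with nonnegative coefficients
  and \<open>p(1) = c\<close>, so that \<open>norm U \<le> c\<close> if \<open>norm B \<le> 1\<close>.\<close>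

inductive nonneg_comb :: "('a::real_vector \<Rightarrow> 'a) \<Rightarrow> real \<Rightarrow> ('a \<Rightarrow> 'a) \<Rightarrow> bool"
  for B where
  zero: "nonneg_comb B 0 (\<lambda>x. 0)"
| ident: "nonneg_comb B 1 (\<lambda>x. x)"
| step: "nonneg_comb B c U \<Longrightarrow> nonneg_comb B c (\<lambda>x. B (U x))"
| add: "nonneg_comb B c U \<Longrightarrow> nonneg_comb B d V \<Longrightarrow> nonneg_comb B (c + d) (\<lambda>x. U x + V x)"
| scale: "nonneg_comb B c U \<Longrightarrow> 0 \<le> r \<Longrightarrow> nonneg_comb B (r * c) (\<lambda>x. r *\<^sub>R U x)"

lemma nonneg_comb_compose:
  assumes "nonneg_comb B c U" "nonneg_comb B d V"
  shows "nonneg_comb B (c * d) (\<lambda>x. U (V x))"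
  using assms(1)
proof induction
  case (step c U)
  then show ?case
    using nonneg_comb.step by blast
next
  case (add c U c' U')
  then show ?case
    by (simp add: distrib_right nonneg_comb.add)
next
  case (scale c U r)
  then show ?case
    by (simp add: mult.assoc nonneg_comb.scale)
qed (simp_all add: nonneg_comb.zero assms(2))

lemma nonneg_comb_bounded_clinear:
  "nonneg_comb B c U \<Longrightarrow> bounded_clinear B \<Longrightarrow> bounded_clinear U"
  by (induction rule: nonneg_comb.induct) (simp_all add: bounded_clinear_intros bounded_clinear_compose)

lemma nonneg_comb_norm_le:
  assumes "nonneg_comb B c U" and B: "\<And>x. norm (B x) \<le> norm x"
  shows "norm (U x) \<le> c * norm x"
  using assms(1)
proof (induction arbitrary: x)
  case (step c U)
  then show ?case
    using B order_trans by blast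
next
  case (add c U d V)
  then show ?case
    using norm_triangle_mono[OF add.IH] by (simp add: distrib_right)
next
  case (scale c U r)
  then show ?case
    by (simp add: mult.assoc mult_left_mono)
qed simp_all

lemma nonneg_comb_commute:
  assumes "nonneg_comb B c U" "linear E" "\<And>x. E (B x) = B (E x)"
  shows "E (U x) = U (E x)"
  using assms(1)
  by (induction arbitrary: x)
     (simp_all add: assms(3) linear_add[OF assms(2)] linear_scale[OF assms(2)] linear_0[OF assms(2)])

lemma nonneg_comb_sym:
  assumes "nonneg_comb B c U" "linear B" and B: "\<And>x y. inner (B x) y = inner x (B y)"
  shows "inner (U x) y = inner x (U y)"
  using assms(1)
proof (induction arbitrary: x y)
  case (step c U)
  then show ?case
    using nonneg_comb_commute[OF step.hyps assms(2)] by (simp add: B)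
qed (simp_all add: inner_add)

text \<open>The iteration \<open>Y \<mapsto> (B + Y\<^sup>2) / 2\<close> converges to \<open>I - (I - B)\<^sup>1\<^sup>/\<^sup>2\<close>.\<close>

fun sqrt_iter :: "('a::real_vector \<Rightarrow> 'a) \<Rightarrow> nat \<Rightarrow> 'a \<Rightarrow> 'a" where
  "sqrt_iter B 0 = (\<lambda>x. 0)"
| "sqrt_iter B (Suc n) = (\<lambda>x. (1/2) *\<^sub>R (B x + sqrt_iter B n (sqrt_iter B n x)))"

text \<open>The scalar run of the same iteration with \<open>B\<close> replaced by 1: the
  coefficient sum of the polynomial in \<open>B\<close> that \<open>sqrt_iter B n\<close>
  is.\<close>

fun sqrt_iter_sum :: "nat \<Rightarrow> real" where
  "sqrt_iter_sum 0 = 0"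
| "sqrt_iter_sum (Suc n) = (1/2) * (1 + sqrt_iter_sum n * sqrt_iter_sum n)"

lemma sqrt_iter_nonneg_comb: "nonneg_comb B (sqrt_iter_sum n) (sqrt_iter B n)"
proof (induction n)
  case (Suc n)
  have "nonneg_comb B 1 (\<lambda>x. B x)"
    using nonneg_comb.step[OF nonneg_comb.ident] .
  from nonneg_comb.scale[OF nonneg_comb.add[OF this nonneg_comb_compose[OF Suc Suc]], of "1/2"]
  show ?case
    by simp
qed (simp add: nonneg_comb.zero)

text \<open>If \<open>D\<close> is the increment from \<open>Y\<close> to \<open>Y'\<close>, the
  next increment is \<open>(D Y' + Y D) / 2\<close>, so nonnegative coefficients propagate. The
  norms of the increments are thereby dominated by the increments of
  \<open>sqrt_iter_sum\<close>.\<close>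

lemma sqrt_iter_diff_nonneg_comb:
  assumes "bounded_clinear B"
  shows "nonneg_comb B (sqrt_iter_sum (Suc n) - sqrt_iter_sum n)
    (\<lambda>x. sqrt_iter B (Suc n) x - sqrt_iter B n x)"
proof (induction n)
  case 0
  show ?case
    using nonneg_comb.scale[OF nonneg_comb.step[OF nonneg_comb.ident], of "1/2" B] by simp
next
  case (Suc n)
  define Y Y' D where "Y = sqrt_iter B n" and "Y' = sqrt_iter B (Suc n)" and "D x = Y' x - Y x" for x
  define c c' where "c = sqrt_iter_sum n" and "c' = sqrt_iter_sum (Suc n)"
  have comb: "nonneg_comb B c Y" "nonneg_comb B c' Y'"
    unfolding c_def Y_def c'_def Y'_def by (rule sqrt_iter_nonneg_comb)+
  have D: "nonneg_comb B (c' - c) D"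
    using Suc unfolding D_def Y_def Y'_def c_def c'_def .
  have "linear Y"
    using nonneg_comb_bounded_clinear[OF comb(1) assms] by (rule bounded_clinear_linear)
  have "nonneg_comb B ((1/2) * ((c' - c) * c' + c * (c' - c)))
      (\<lambda>x. (1/2) *\<^sub>R (D (Y' x) + Y (D x)))"
    by (intro nonneg_comb.scale nonneg_comb.add nonneg_comb_compose comb D) simp
  also have "(1/2) * ((c' - c) * c' + c * (c' - c)) = sqrt_iter_sum (Suc (Suc n)) - sqrt_iter_sum (Suc n)"
  proof -
    have "sqrt_iter_sum (Suc (Suc n)) = (1/2) * (1 + c' * c')"
      unfolding c'_def by (rule sqrt_iter_sum.simps)
    moreover have "sqrt_iter_sum (Suc n) = (1/2) * (1 + c * c)"
      unfolding c_def by (rule sqrt_iter_sum.simps)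
    ultimately show ?thesis
      by (simp only: right_diff_distrib left_diff_distrib distrib_left mult.commute[of c c'])
  qed
  also have "(\<lambda>x. (1/2) *\<^sub>R (D (Y' x) + Y (D x))) =
      (\<lambda>x. sqrt_iter B (Suc (Suc n)) x - sqrt_iter B (Suc n) x)"
  proof
    fix x
    have "sqrt_iter B (Suc (Suc n)) x = (1/2) *\<^sub>R (B x + Y' (Y' x))"
      unfolding Y'_def by simp
    moreover have "sqrt_iter B (Suc n) x = (1/2) *\<^sub>R (B x + Y (Y x))"
      unfolding Y_def by simp
    ultimately show "(1/2) *\<^sub>R (D (Y' x) + Y (D x)) =
        sqrt_iter B (Suc (Suc n)) x - sqrt_iter B (Suc n) x"
      by (simp add: D_def linear_diff[OF \<open>linear Y\<close>] algebra_simps)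
  qed
  finally show ?case .
qed

lemma sqrt_iter_sum_le_1: "0 \<le> sqrt_iter_sum n \<and> sqrt_iter_sum n \<le> 1"
proof (induction n)
  case (Suc n)
  then have "sqrt_iter_sum n * sqrt_iter_sum n \<le> 1"
    by (simp add: mult_le_one)
  then show ?case
    using Suc by simp
qed simp

lemma sqrt_iter_sum_mono: "sqrt_iter_sum n \<le> sqrt_iter_sum (Suc n)"
proof -
  have "0 \<le> (sqrt_iter_sum n - 1)\<^sup>2"
    by simp
  then show ?thesis
    by (simp add: power2_eq_square algebra_simps)
qed

text \<open>Domination by a bounded increasing scalar sequence makes the iterates converge to some
  \<open>L\<close> with \<open>L = (B + L^2) / 2\<close>, that is \<open>(I - L)^2 = I - B\<close>.
  The commutation clause is inherited from polynomials in \<open>B\<close>; uniqueness of the root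
  rests on it.\<close>

lemma sqrt_contraction_exists:
  fixes B :: "'a::complex_hilbert_space \<Rightarrow> 'a"
  assumes B: "bounded_clinear B" and le: "\<And>x. norm (B x) \<le> norm x"
    and sym: "\<And>x y. inner (B x) y = inner x (B y)"
  shows "\<exists>R. positive_op R \<and> (\<forall>x. R (R x) = x - B x) \<and>
    (\<forall>E. bounded_linear E \<and> (\<forall>x. E (B x) = B (E x)) \<longrightarrow> (\<forall>x. E (R x) = R (E x)))"
proof -
  define Y where "Y = sqrt_iter B"
  have comb: "nonneg_comb B (sqrt_iter_sum n) (Y n)" for n
    unfolding Y_def by (rule sqrt_iter_nonneg_comb)
  have Y_bc: "bounded_clinear (Y n)" for n
    by (rule nonneg_comb_bounded_clinear[OF comb B])
  have Y_le: "norm (Y n x) \<le> norm x" for n x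
  proof -
    have "norm (Y n x) \<le> sqrt_iter_sum n * norm x"
      by (rule nonneg_comb_norm_le[OF comb le])
    also have "\<dots> \<le> 1 * norm x"
      using sqrt_iter_sum_le_1 by (intro mult_right_mono) auto
    finally show ?thesis
      by simp
  qed
  have step: "norm (Y (Suc n) x - Y n x) \<le> (sqrt_iter_sum (Suc n) - sqrt_iter_sum n) * norm x" for n x
    unfolding Y_def by (rule nonneg_comb_norm_le[OF sqrt_iter_diff_nonneg_comb[OF B] le])
  have diff: "norm (Y (n + k) x - Y n x) \<le> (sqrt_iter_sum (n + k) - sqrt_iter_sum n) * norm x" for n k x
  proof (induction k)
    case (Suc k)
    have "norm (Y (n + Suc k) x - Y n x) \<le>
        norm (Y (Suc (n + k)) x - Y (n + k) x) + norm (Y (n + k) x - Y n x)"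
      using norm_triangle_ineq[of "Y (Suc (n + k)) x - Y (n + k) x" "Y (n + k) x - Y n x"] by simp
    also have "\<dots> \<le> (sqrt_iter_sum (Suc (n + k)) - sqrt_iter_sum (n + k)) * norm x
        + (sqrt_iter_sum (n + k) - sqrt_iter_sum n) * norm x"
      by (intro add_mono step Suc)
    finally show ?case
      by (simp add: algebra_simps)
  qed simp
  have "convergent sqrt_iter_sum"
    using sqrt_iter_sum_le_1 sqrt_iter_sum_mono
    by (intro Bseq_monoseq_convergent BseqI'[of _ 1] monoI1 incseq_imp_monoseq incseq_SucI) auto
  then have sum_Cauchy: "Cauchy sqrt_iter_sum"
    by (rule convergent_Cauchy)
  have "Cauchy (\<lambda>n. Y n x)" for x
  proof (rule CauchyI')
    fix e :: real
    assume "e > 0"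
    then have "e / (norm x + 1) > 0"
      by (simp add: add_nonneg_pos)
    then obtain M where M: "\<And>m n. m \<ge> M \<Longrightarrow> n \<ge> M \<Longrightarrow>
        dist (sqrt_iter_sum m) (sqrt_iter_sum n) < e / (norm x + 1)"
      using sum_Cauchy unfolding Cauchy_def by blast
    have "dist (Y m x) (Y n x) < e" if "m \<ge> M" "m < n" for m n
    proof -
      have "norm (Y n x - Y m x) \<le> (sqrt_iter_sum n - sqrt_iter_sum m) * norm x"
        using diff[of m "n - m" x] that by simp
      also have "\<dots> \<le> (e / (norm x + 1)) * norm x"
        using M[of n m] that by (intro mult_right_mono) (auto simp: dist_real_def)
      also have "\<dots> < e"
        using \<open>e > 0\<close> by (simp add: divide_less_eq add_nonneg_pos)
      finally show ?thesis
        by (simp add: dist_norm norm_minus_commute)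
    qed
    then show "\<exists>M. \<forall>m\<ge>M. \<forall>n>m. dist (Y m x) (Y n x) < e"
      by blast
  qed
  then have "\<exists>l. (\<lambda>n. Y n x) \<longlonglongrightarrow> l" for x
    using Cauchy_convergent convergent_def by blast
  then obtain L where L: "\<And>x. (\<lambda>n. Y n x) \<longlonglongrightarrow> L x"
    by metis
  have L_le: "norm (L x) \<le> norm x" for x
    using LIMSEQ_le_const2[OF tendsto_norm[OF L]] Y_le by blast
  have L_bl: "bounded_linear L"
  proof (rule bounded_linear_intro)
    show "L (x + y) = L x + L y" for x y
    proof (rule LIMSEQ_unique[OF L])
      show "(\<lambda>n. Y n (x + y)) \<longlonglongrightarrow> L x + L y"
        using tendsto_add[OF L L, of x y] by (simp add: linear_add[OF bounded_clinear_linear[OF Y_bc]])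
    qed
    show "L (r *\<^sub>R x) = r *\<^sub>R L x" for r x
    proof (rule LIMSEQ_unique[OF L])
      show "(\<lambda>n. Y n (r *\<^sub>R x)) \<longlonglongrightarrow> r *\<^sub>R L x"
        using tendsto_scaleR[OF tendsto_const L, of r x]
        by (simp add: linear_scale[OF bounded_clinear_linear[OF Y_bc]])
    qed
    show "norm (L x) \<le> norm x * 1" for x
      by (simp add: L_le)
  qed
  have L_commute: "E (L x) = L (E x)"
    if E: "bounded_linear E" and EB: "\<And>x. E (B x) = B (E x)" for E x
  proof (rule LIMSEQ_unique)
    show "(\<lambda>n. E (Y n x)) \<longlonglongrightarrow> E (L x)"
      by (intro bounded_linear.tendsto[OF E] L)
    show "(\<lambda>n. E (Y n x)) \<longlonglongrightarrow> L (E x)"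
      using L[of "E x"] nonneg_comb_commute[OF comb bounded_linear.linear[OF E] EB] by simp
  qed
  have L_i: "L (\<i> *\<^sub>C x) = \<i> *\<^sub>C L x" for x
  proof -
    \<comment> \<open>Multiplication by \<open>\<i>\<close> is a real-linear isometry commuting with
      \<open>B\<close>, so \<open>L_commute\<close> yields complex linearity of the limit.\<close>
    have "norm (\<i> *\<^sub>C z) = norm z" for z :: 'a
      by (simp add: norm_eq_sqrt_inner inner_scaleC_i)
    then have "bounded_linear (\<lambda>z::'a. \<i> *\<^sub>C z)"
      by (intro bounded_linear_intro[where K=1])
         (simp_all add: scaleC_add_right scaleC_scaleR_commute)
    then show ?thesis
      using L_commute[of "\<lambda>z. \<i> *\<^sub>C z"] by (simp add: bounded_clinear_scaleC[OF B])
  qed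
  have L_bc: "bounded_clinear L"
    using L_bl L_i by (rule bounded_clinearI)
  have L_sym: "inner (L x) y = inner x (L y)" for x y
  proof (rule LIMSEQ_unique)
    show "(\<lambda>n. inner (Y n x) y) \<longlonglongrightarrow> inner (L x) y"
      by (intro tendsto_intros L)
    have "(\<lambda>n. inner x (Y n y)) \<longlonglongrightarrow> inner x (L y)"
      by (intro tendsto_intros L)
    then show "(\<lambda>n. inner (Y n x) y) \<longlonglongrightarrow> inner x (L y)"
      by (simp add: nonneg_comb_sym[OF comb bounded_clinear_linear[OF B] sym])
  qed
  have L_fixed: "L x = (1/2) *\<^sub>R (B x + L (L x))" for x
  proof (rule LIMSEQ_unique)
    show "(\<lambda>n. Y (Suc n) x) \<longlonglongrightarrow> L x"
      using L by (rule LIMSEQ_Suc)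
    have "(\<lambda>n. Y n (Y n x - L x)) \<longlonglongrightarrow> 0"
    proof (rule Lim_null_comparison)
      show "\<forall>\<^sub>F n in sequentially. norm (Y n (Y n x - L x)) \<le> norm (Y n x - L x)"
        by (simp add: Y_le)
      show "(\<lambda>n. norm (Y n x - L x)) \<longlonglongrightarrow> 0"
        using L by (metis LIM_zero tendsto_norm_zero)
    qed
    from tendsto_add[OF this L[of "L x"]] have "(\<lambda>n. Y n (Y n x)) \<longlonglongrightarrow> L (L x)"
      by (simp add: linear_diff[OF bounded_clinear_linear[OF Y_bc]])
    then have "(\<lambda>n. (1/2) *\<^sub>R (B x + Y n (Y n x))) \<longlonglongrightarrow> (1/2) *\<^sub>R (B x + L (L x))"
      by (intro tendsto_intros)
    then show "(\<lambda>n. Y (Suc n) x) \<longlonglongrightarrow> (1/2) *\<^sub>R (B x + L (L x))"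
      by (simp add: Y_def)
  qed
  define R where "R x = x - L x" for x
  have "positive_op R"
  proof (rule positive_opI)
    show "bounded_clinear R"
      unfolding R_def by (intro bounded_clinear_intros L_bc)
    show "inner (R x) y = inner x (R y)" for x y
      by (simp add: R_def inner_diff L_sym)
    show "0 \<le> inner (R x) x" for x
    proof -
      have "inner (L x) x \<le> norm (L x) * norm x"
        by (rule norm_cauchy_schwarz)
      also have "\<dots> \<le> norm x * norm x"
        by (intro mult_right_mono L_le) simp
      finally show ?thesis
        by (simp add: R_def inner_diff power2_norm_eq_inner flip: power2_eq_square)
    qed
  qed
  moreover have "R (R x) = x - B x" for x
  proof -
    have "2 *\<^sub>R L x = B x + L (L x)"
      using arg_cong[OF L_fixed, of "\<lambda>z. 2 *\<^sub>R z" x] by simp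
    then have "L (L x) = 2 *\<^sub>R L x - B x"
      by simp
    then show ?thesis
      by (simp add: R_def linear_diff[OF bounded_clinear_linear[OF L_bc]] scaleR_2)
  qed
  moreover have "E (R x) = R (E x)" if "bounded_linear E" "\<forall>x. E (B x) = B (E x)" for E x
    using L_commute[of E] that by (simp add: R_def linear_diff[OF bounded_linear.linear])
  ultimately show ?thesis
    by blast
qed

lemma sqrt_exists:
  assumes S: "positive_op S"
  shows "\<exists>R. positive_op R \<and> R \<circ> R = S \<and>
    (\<forall>E. bounded_linear E \<and> (\<forall>x. E (S x) = S (E x)) \<longrightarrow> (\<forall>x. E (R x) = R (E x)))"
proof -
  have bc: "bounded_clinear S"
    using S by (rule positive_op_bounded)
  obtain K where K: "K > 0" "\<And>x. norm (S x) \<le> K * norm x"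
    using bounded_clinear_norm_bound[OF bc] by blast
  \<comment> \<open>From \<open>0 <= S <= K I\<close> follows \<open>0 <= B <= I\<close>, and
    \<open>I - B = S / K\<close>; the root of the latter is rescaled by
    \<open>sqrt K\<close>.\<close>
  define B where "B x = x - (1/K) *\<^sub>R S x" for x
  have B_bc: "bounded_clinear B"
    unfolding B_def by (intro bounded_clinear_intros bc)
  have B_sym: "inner (B x) y = inner x (B y)" for x y
    by (simp add: B_def inner_diff positive_op_sym[OF S])
  have S_le: "inner (S x) x \<le> K * (norm x)\<^sup>2" for x
  proof -
    have "inner (S x) x \<le> norm (S x) * norm x"
      by (rule norm_cauchy_schwarz)
    also have "\<dots> \<le> K * norm x * norm x"
      by (intro mult_right_mono K) simp
    finally show ?thesis
      by (simp add: power2_eq_square)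
  qed
  have B_inner: "inner (B x) x = (norm x)\<^sup>2 - inner (S x) x / K" for x
    by (simp add: B_def inner_diff power2_norm_eq_inner)
  have "positive_op B"
    using B_bc B_sym
    by (rule positive_opI) (use S_le K(1) in \<open>simp add: B_inner pos_divide_le_eq mult.commute\<close>)
  then have B_le: "norm (B x) \<le> norm x" for x
    by (rule positive_op_norm_le) (use positive_op_nonneg[OF S] K(1) in \<open>simp add: B_inner\<close>)
  obtain Q where Q: "positive_op Q" "\<And>x. Q (Q x) = x - B x"
    and Q_comm: "\<And>E x. bounded_linear E \<Longrightarrow> (\<And>x. E (B x) = B (E x)) \<Longrightarrow> E (Q x) = Q (E x)"
    using sqrt_contraction_exists[OF B_bc B_le B_sym] by blast
  define R where "R x = sqrt K *\<^sub>R Q x" for x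
  have Q_lin: "linear Q"
    using Q(1) by (simp add: bounded_clinear_linear positive_op_bounded)
  have "positive_op R"
  proof (rule positive_opI)
    show "bounded_clinear R"
      unfolding R_def using Q(1) by (intro bounded_clinear_intros positive_op_bounded)
    show "inner (R x) y = inner x (R y)" for x y
      by (simp add: R_def positive_op_sym[OF Q(1)])
    show "0 \<le> inner (R x) x" for x
      using K(1) by (simp add: R_def positive_op_nonneg[OF Q(1)])
  qed
  moreover have "R (R x) = S x" for x
  proof -
    have "R (R x) = (sqrt K * sqrt K) *\<^sub>R Q (Q x)"
      by (simp add: R_def linear_scale[OF Q_lin] del: real_sqrt_mult_self)
    also have "\<dots> = S x"
      using K(1) by (simp add: Q(2) B_def)
    finally show ?thesis .
  qed
  moreover have "E (R x) = R (E x)" if E: "bounded_linear E" and ES: "\<And>x. E (S x) = S (E x)" for E x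
  proof -
    have "E (B x) = B (E x)" for x
      using E ES by (simp add: B_def linear_diff linear_scale bounded_linear.linear)
    then show ?thesis
      using Q_comm[OF E] E by (simp add: R_def linear_scale bounded_linear.linear)
  qed
  ultimately show ?thesis
    by (intro exI[of _ R]) auto
qed

text \<open>For \<open>y = (R - R') x\<close> commutation gives \<open>(R + R') y = 0\<close>. Both
  nonnegative forms then vanish at \<open>y\<close>, so \<open>R y = R' y = 0\<close>, and
  \<open>|y|^2 = inner x ((R - R') y) = 0\<close>.\<close>

lemma sqrt_unique:
  assumes R: "positive_op R" "positive_op R'" and eq: "R' \<circ> R' = R \<circ> R"
    and comm: "\<And>x. R' (R x) = R (R' x)"
  shows "R' = R"
proof
  fix x
  have lin: "linear R" "linear R'"
    using R by (simp_all add: bounded_clinear_linear positive_op_bounded)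
  have eq': "R' (R' x) = R (R x)" for x
    using fun_cong[OF eq, of x] by simp
  define y where "y = R x - R' x"
  have Ry: "R y = - R' y"
    by (simp add: y_def linear_diff lin comm eq')
  have "inner (R y) y = 0"
    using positive_op_nonneg[OF R(1), of y] positive_op_nonneg[OF R(2), of y] by (simp add: Ry)
  then have "R y = 0"
    using R(1) positive_op_zero by blast
  then have "R' y = 0"
    using Ry by simp
  have "inner y y = inner x (R y) - inner x (R' y)"
    by (subst (1) y_def) (simp add: inner_diff_left positive_op_sym[OF R(1)] positive_op_sym[OF R(2)])
  then have "inner y y = 0"
    using \<open>R y = 0\<close> \<open>R' y = 0\<close> by simp
  then show "R' x = R x"
    by (simp add: y_def)
qed

text \<open>Every root commutes with its square \<open>S\<close>, hence with the root obtained from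
  polynomials in \<open>S\<close>, and so coincides with it.\<close>

lemma sqrt_op_eqI:
  assumes S: "positive_op S" and R: "positive_op R" "R \<circ> R = S"
  shows "sqrt_op S = R"
proof -
  obtain Q where Q: "positive_op Q" "Q \<circ> Q = S"
    and Q_comm: "\<And>E x. bounded_linear E \<Longrightarrow> (\<And>x. E (S x) = S (E x)) \<Longrightarrow> E (Q x) = Q (E x)"
    using sqrt_exists[OF S] by blast
  have uniq: "R' = Q" if R': "positive_op R'" "R' \<circ> R' = S" for R'
  proof (rule sqrt_unique)
    show "R' (Q x) = Q (R' x)" for x
      using R' by (intro Q_comm positive_op_bounded_linear) auto
  qed (use R' Q in auto)
  show ?thesis
    unfolding sqrt_op_def using R uniq by (intro the_equality) metis+
qed

lemma
  assumes "positive_op S"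
  shows positive_op_sqrt_op: "positive_op (sqrt_op S)"
    and sqrt_op_sqrt_op: "sqrt_op S (sqrt_op S x) = S x"
    and sqrt_op_commute: "bounded_linear E \<Longrightarrow> (\<And>x. E (S x) = S (E x)) \<Longrightarrow>
      E (sqrt_op S x) = sqrt_op S (E x)"
proof -
  obtain Q where Q: "positive_op Q" "Q \<circ> Q = S"
    and Q_comm: "\<And>E x. bounded_linear E \<Longrightarrow> (\<And>x. E (S x) = S (E x)) \<Longrightarrow> E (Q x) = Q (E x)"
    using sqrt_exists[OF assms] by blast
  have "sqrt_op S = Q"
    using assms Q by (rule sqrt_op_eqI)
  then show "positive_op (sqrt_op S)" "sqrt_op S (sqrt_op S x) = S x"
    "bounded_linear E \<Longrightarrow> (\<And>x. E (S x) = S (E x)) \<Longrightarrow> E (sqrt_op S x) = sqrt_op S (E x)"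
    using Q(1) fun_cong[OF Q(2), of x] Q_comm by simp_all
qed

lemma norm_sqrt_op: "positive_op S \<Longrightarrow> (norm (sqrt_op S x))\<^sup>2 = inner (S x) x"
  by (simp add: power2_norm_eq_inner positive_op_sym[OF positive_op_sqrt_op] sqrt_op_sqrt_op
      inner_commute)

lemma positive_op_compose_commute:
  assumes S: "positive_op S" and T: "positive_op T" and comm: "\<And>x. S (T x) = T (S x)"
  shows "positive_op (\<lambda>x. S (T x))"
proof (rule positive_opI)
  show "bounded_clinear (\<lambda>x. S (T x))"
    using S T by (simp add: bounded_clinear_compose positive_op_bounded)
  show "inner (S (T x)) y = inner x (S (T y))" for x y
    by (simp add: positive_op_sym[OF S] positive_op_sym[OF T] comm)
  show "0 \<le> inner (S (T x)) x" for x
  proof -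
    have "S (T x) = S (sqrt_op T (sqrt_op T x))"
      by (simp add: sqrt_op_sqrt_op[OF T])
    also have "\<dots> = sqrt_op T (S (sqrt_op T x))"
      by (rule sqrt_op_commute[OF T positive_op_bounded_linear[OF S] comm])
    finally have "inner (S (T x)) x = inner (S (sqrt_op T x)) (sqrt_op T x)"
      by (simp add: positive_op_sym[OF positive_op_sqrt_op[OF T]])
    then show ?thesis
      by (simp add: positive_op_nonneg[OF S])
  qed
qed

text \<open>Douglas' range criterion: the bound makes \<open>inner g z\<close> a bounded functional
  of \<open>sqrt_op S z\<close>. If \<open>v\<close> represents it, then
  \<open>g = sqrt_op S v\<close> by symmetry of the root.\<close>

lemma range_sqrt_opI:
  assumes S: "positive_op S" and bound: "\<And>z. \<bar>inner g z\<bar> \<le> c * norm (sqrt_op S z)" and "c \<ge> 0"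
  shows "g \<in> range (sqrt_op S)"
proof -
  define R where "R = sqrt_op S"
  have R: "positive_op R"
    unfolding R_def using S by (rule positive_op_sqrt_op)
  interpret bounded_linear R
    using R by (rule positive_op_bounded_linear)
  define W where "W = range (\<lambda>z. (R z, inner g z))"
  have "linear (\<lambda>z. (R z, inner g z))"
    by (intro linearI) (simp_all add: add scaleR inner_add_right)
  then have "subspace W"
    unfolding W_def by (rule linear_subspace_image) simp
  then have "\<exists>v \<in> closure (fst ` W). norm v \<le> c \<and> (\<forall>(l, t) \<in> W. t = inner l v)"
    by (rule riesz_graph) (use bound \<open>c \<ge> 0\<close> in \<open>auto simp: W_def R_def\<close>)
  then obtain v where "\<And>z. inner g z = inner (R z) v"
    by (auto simp: W_def)
  then have "inner z g = inner z (R v)" for z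
    using positive_op_sym[OF R] by (metis inner_commute)
  then have "g = R v"
    by (rule eq_if_inner_eq)
  then show ?thesis
    by (simp add: R_def)
qed


section \<open>Defect operators\<close>

lemma
  fixes T :: "'a::complex_hilbert_space \<Rightarrow> 'b::complex_hilbert_space"
  assumes "contraction T"
  shows positive_op_defect: "positive_op (defect T)"
    and positive_op_defect_sq: "positive_op (defect_sq T)"
    and defect_defect: "defect T (defect T x) = x - cadjoint T (T x)"
    and defect_eq_sqrt_op: "defect T = sqrt_op (defect_sq T)"
    and norm_defect: "(norm (defect T x))\<^sup>2 = (norm x)\<^sup>2 - (norm (T x))\<^sup>2"
proof -
  note T = contraction_bounded_clinear[OF assms] and le = contraction_norm_le[OF assms]
  define S where "S x = x - cadjoint T (T x)" for x
  have inner_S: "inner (S x) y = inner x y - inner (T x) (T y)" for x y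
    by (simp add: S_def inner_diff inner_commute[of "cadjoint T (T x)"]
        inner_commute[of _ "T y"] flip: inner_cadjoint[OF T])
  have S: "positive_op S"
  proof (rule positive_opI)
    show "bounded_clinear S"
      unfolding S_def
      by (intro bounded_clinear_intros bounded_clinear_compose[OF bounded_clinear_cadjoint] T)
    show "inner (S x) y = inner x (S y)" for x y
      using inner_S[of x y] inner_S[of y x] by (simp add: inner_commute)
    show "0 \<le> inner (S x) x" for x
      using power_mono[OF le, of x 2] by (simp add: inner_S flip: power2_norm_eq_inner)
  qed
  have D: "defect T = sqrt_op S"
    by (simp add: defect_def S_def[abs_def])
  then have sq: "defect_sq T = S"
    by (auto simp: defect_sq_def sqrt_op_sqrt_op[OF S])
  show "positive_op (defect T)" "positive_op (defect_sq T)" "defect T = sqrt_op (defect_sq T)"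
    "defect T (defect T x) = x - cadjoint T (T x)"
    using D sq positive_op_sqrt_op[OF S] S sqrt_op_sqrt_op[OF S, of x] by (simp_all add: S_def)
  show "(norm (defect T x))\<^sup>2 = (norm x)\<^sup>2 - (norm (T x))\<^sup>2"
    by (simp add: D norm_sqrt_op[OF S] inner_S flip: power2_norm_eq_inner)
qed


section \<open>Shorted operators\<close>

lemma projection_op_exists:
  fixes V :: "'a::complex_hilbert_space set"
  assumes V: "subspace V" "closed V" and V_i: "\<And>x. x \<in> V \<Longrightarrow> \<i> *\<^sub>C x \<in> V"
  shows "\<exists>P. bounded_clinear P \<and> (\<forall>x. P x \<in> V) \<and> (\<forall>x. \<forall>v\<in>V. inner v (x - P x) = 0)"
proof -
  have "\<exists>v\<in>V. \<forall>u\<in>V. inner u (x - v) = 0" for x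
    using orthogonal_projection_exists[OF V(1), of x] V(2) by simp
  then obtain P where P: "\<And>x. P x \<in> V" "\<And>x u. u \<in> V \<Longrightarrow> inner u (x - P x) = 0"
    by metis
  have uniq: "P x = v" if "v \<in> V" "\<And>u. u \<in> V \<Longrightarrow> inner u (x - v) = 0" for x v
  proof -
    have d: "P x - v \<in> V"
      using V(1) P(1) that(1) by (rule subspace_diff)
    have "inner (P x - v) (P x - v) = inner (P x - v) (x - v) - inner (P x - v) (x - P x)"
      by (simp add: inner_diff_right)
    then have "inner (P x - v) (P x - v) = 0"
      using that(2)[OF d] P(2)[OF d, of x] by simp
    then show ?thesis
      by simp
  qed
  have "bounded_clinear P"
  proof (intro bounded_clinearI bounded_linear_intro)
    show "P (x + y) = P x + P y" for x y
    proof (rule uniq)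
      show "P x + P y \<in> V"
        using V(1) P(1) by (intro subspace_add)
      show "inner u (x + y - (P x + P y)) = 0" if "u \<in> V" for u
        using P(2)[OF that, of x] P(2)[OF that, of y] by (simp add: inner_diff_right inner_add_right)
    qed
    show "P (r *\<^sub>R x) = r *\<^sub>R P x" for r x
    proof (rule uniq)
      show "r *\<^sub>R P x \<in> V"
        using V(1) P(1) by (intro subspace_scale)
      show "inner u (r *\<^sub>R x - r *\<^sub>R P x) = 0" if "u \<in> V" for u
        using P(2)[OF that, of x] by (simp flip: scaleR_diff_right)
    qed
    show "P (\<i> *\<^sub>C x) = \<i> *\<^sub>C P x" for x
    proof (rule uniq)
      show "\<i> *\<^sub>C P x \<in> V"
        using V_i P(1) .
      show "inner u (\<i> *\<^sub>C x - \<i> *\<^sub>C P x) = 0" if "u \<in> V" for u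
        using P(2)[OF V_i[OF that], of x] by (simp add: inner_scaleC_i flip: scaleC_diff_right)
    qed
    show "norm (P x) \<le> norm x * 1" for x
    proof -
      have "norm (P x) * norm (P x) = inner (P x) x"
        using P(2)[OF P(1), of x x]
        by (simp add: inner_diff_right power2_norm_eq_inner flip: power2_eq_square)
      also have "\<dots> \<le> norm (P x) * norm x"
        by (rule norm_cauchy_schwarz)
      finally show ?thesis
        by (cases "P x = 0") auto
    qed
  qed
  then show ?thesis
    using P by blast
qed

lemma closed_vimage_bounded_linear:
  "bounded_linear f \<Longrightarrow> closed K \<Longrightarrow> closed (f -` K)"
  by (intro continuous_closed_vimage) (auto intro: linear_continuous_at)

lemma mem_fst_space_iff: "z \<in> fst_space \<longleftrightarrow> snd z = 0"
  by (cases z) (simp add: fst_space_def)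

lemma closed_fst_space:
  "closed (fst_space :: ('h::complex_hilbert_space \<times> 'm::complex_hilbert_space) set)"
  unfolding fst_space_def by (intro closed_Times) simp_all

text \<open>Krein's formula: the shorted operator is the root of \<open>S\<close>, then the
  projection onto the preimage of the subspace under this root, then the root again. Its form at
  \<open>x\<close> is the infimum of the form of \<open>S\<close> over shifts of \<open>x\<close> in
  the second summand.\<close>

lemma shorted_exists:
  fixes S :: "'h::complex_hilbert_space \<times> 'm::complex_hilbert_space \<Rightarrow> 'h \<times> 'm"
  assumes S: "positive_op S"
  defines "V \<equiv> sqrt_op S -` fst_space"
  shows "\<exists>P. bounded_clinear P \<and> (\<forall>x. P x \<in> V) \<and> (\<forall>x. \<forall>v\<in>V. inner v (x - P x) = 0) \<and>
    shorted S fst_space = (\<lambda>x. sqrt_op S (P (sqrt_op S x))) \<and> positive_op (shorted S fst_space)"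
proof -
  define R where "R = sqrt_op S"
  have R: "positive_op R"
    unfolding R_def using S by (rule positive_op_sqrt_op)
  note R_bc = positive_op_bounded[OF R] and R_sym = positive_op_sym[OF R]
  have R_lin: "linear R"
    using R_bc by (rule bounded_clinear_linear)
  have V: "subspace V" "closed V"
  proof -
    have "subspace (fst_space :: ('h \<times> 'm) set)"
      by (simp add: subspace_def mem_fst_space_iff)
    then show "subspace V"
      unfolding V_def R_def[symmetric] using R_lin by (metis linear_subspace_vimage)
    show "closed V"
      unfolding V_def R_def[symmetric]
      by (rule closed_vimage_bounded_linear[OF bounded_clinear_bounded_linear[OF R_bc] closed_fst_space])
  qed
  have zero: "\<i> *\<^sub>C (0::'m) = 0"
    using bounded_clinear_scaleC[OF bounded_clinear_zero] by metis
  have V_i: "\<i> *\<^sub>C x \<in> V" if "x \<in> V" for x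
    using that bounded_clinear_scaleC[OF R_bc, of \<i> x]
    by (simp add: V_def R_def[symmetric] mem_fst_space_iff) (simp add: scaleC_prod_def zero)
  obtain P where P: "bounded_clinear P" "\<And>x. P x \<in> V" "\<And>x v. v \<in> V \<Longrightarrow> inner v (x - P x) = 0"
    using projection_op_exists[OF V V_i] by blast
  have P_inner: "inner (P x) y = inner (P x) (P y)" for x y
    using P(3)[OF P(2), of x y] by (simp add: inner_diff_right)
  have P_sym: "inner (P x) y = inner x (P y)" for x y
    using P_inner[of x y] P_inner[of y x] by (simp add: inner_commute)
  define Z where "Z x = R (P (R x))" for x
  have Z_inner: "inner (Z x) x = (norm (P (R x)))\<^sup>2" for x
    using P_inner[of "R x" "R x"] by (simp add: Z_def R_sym power2_norm_eq_inner)
  have Z_bc: "bounded_clinear Z"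
    unfolding Z_def using bounded_clinear_compose[OF R_bc bounded_clinear_compose[OF P(1) R_bc]] .
  have Z_sym: "inner (Z x) y = inner x (Z y)" for x y
    by (simp add: Z_def R_sym P_sym)
  have Z: "positive_op Z"
    using Z_bc Z_sym by (rule positive_opI) (simp add: Z_inner)
  have "op_le Z S"
    unfolding op_le_def
  proof (rule positive_opI)
    show "bounded_clinear (\<lambda>x. S x - Z x)"
      using S Z by (intro bounded_clinear_diff positive_op_bounded)
    show "inner (S x - Z x) y = inner x (S y - Z y)" for x y
      by (simp add: inner_diff positive_op_sym[OF S] Z_sym)
    show "0 \<le> inner (S x - Z x) x" for x
    proof -
      have "inner (S x) x = (norm (R x))\<^sup>2"
        by (simp add: R_def norm_sqrt_op[OF S])
      moreover have "(norm (P (R x)))\<^sup>2 + (norm (R x - P (R x)))\<^sup>2 = (norm (R x))\<^sup>2"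
        using P_inner[of "R x" "R x"]
        by (simp add: power2_norm_eq_inner inner_diff inner_commute)
      ultimately have "inner (S x - Z x) x = (norm (R x - P (R x)))\<^sup>2"
        by (simp add: inner_diff_left Z_inner)
      then show ?thesis
        by simp
    qed
  qed
  moreover have "range Z \<subseteq> fst_space"
    using P(2) by (intro image_subsetI) (simp add: Z_def V_def R_def)
  ultimately have Z_cand: "Z \<in> shorted_candidates S fst_space"
    using Z by (simp add: shorted_candidates_def)
  have Z_max: "op_le Z' Z" if "Z' \<in> shorted_candidates S fst_space" for Z'
  proof -
    have Z': "positive_op Z'" "op_le Z' S" and "range Z' \<subseteq> fst_space"
      using that by (simp_all add: shorted_candidates_def)
    then have ran: "snd (Z' x) = 0" for x
      using mem_fst_space_iff by blast
    show ?thesis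
      unfolding op_le_def
    proof (rule positive_opI)
      show "bounded_clinear (\<lambda>x. Z x - Z' x)"
        using Z Z' by (intro bounded_clinear_diff positive_op_bounded)
      show "inner (Z x - Z' x) y = inner x (Z y - Z' y)" for x y
        by (simp add: inner_diff positive_op_sym[OF Z'(1)] Z_sym)
      show "0 \<le> inner (Z x - Z' x) x" for x
      proof -
        \<comment> \<open>\<open>closure F\<close> is the orthogonal complement of \<open>V\<close>,
          so \<open>R x - r\<close> turns out to be \<open>P (R x)\<close>; it is approximated by
          \<open>R x - f n\<close>.\<close>
        define F where "F = R ` ({0} \<times> UNIV)"
        have "subspace ({0} \<times> UNIV :: ('h \<times> 'm) set)"
          by (auto simp: subspace_def zero_prod_def)
        then have "subspace F"
          unfolding F_def using R_lin by (simp add: linear_subspace_image)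
        then obtain r where r: "r \<in> closure F" and r_orth: "\<And>u. u \<in> F \<Longrightarrow> inner u (R x - r) = 0"
          using orthogonal_projection_exists[of F "R x"] by blast
        have "snd (R (R x - r)) = 0"
        proof (rule eq_zero_if_inner_zero)
          fix m
          have "inner m (snd (R (R x - r))) = inner (0, m) (R (R x - r))"
            by (cases "R (R x - r)") simp
          also have "\<dots> = inner (R (0, m)) (R x - r)"
            by (simp add: R_sym)
          also have "\<dots> = 0"
            by (rule r_orth) (simp add: F_def)
          finally show "inner m (snd (R (R x - r))) = 0" .
        qed
        then have in_V: "R x - r \<in> V"
          by (simp add: V_def mem_fst_space_iff flip: R_def)
        obtain f where f: "\<And>n. f n \<in> F" "f \<longlonglongrightarrow> r"
          using r unfolding closure_sequential by blast
        have V_r: "inner v r = 0" if "v \<in> V" for v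
        proof (rule LIMSEQ_unique)
          show "(\<lambda>n. inner v (f n)) \<longlonglongrightarrow> inner v r"
            by (intro tendsto_intros f)
          have "inner v (f n) = 0" for n
          proof -
            obtain m where "f n = R (0, m)"
              using f(1)[of n] by (auto simp: F_def)
            then show ?thesis
              using that by (cases "R v") (simp add: V_def mem_fst_space_iff flip: R_def R_sym)
          qed
          then show "(\<lambda>n. inner v (f n)) \<longlonglongrightarrow> 0"
            by simp
        qed
        have "P (R x) = R x - r"
        proof -
          define d where "d = P (R x) - (R x - r)"
          have d: "d \<in> V"
            unfolding d_def using V(1) P(2) in_V by (rule subspace_diff)
          have "inner d d = inner d r - inner d (R x - P (R x))"
            by (subst (2) d_def) (simp add: inner_diff_right inner_add_right)
          then show ?thesis
            using V_r[OF d] P(3)[OF d] by (simp add: d_def)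
        qed
        have "inner (Z' x) x \<le> (norm (R x - f n))\<^sup>2" for n
        proof -
          obtain m where m: "f n = R (0, m)"
            using f(1)[of n] by (auto simp: F_def)
          \<comment> \<open>Being symmetric with range in the first summand, \<open>Z'\<close>
            annihilates the second. Shifting \<open>x\<close> by \<open>(0, m)\<close> keeps the
            form of \<open>Z'\<close> and allows comparison with \<open>S\<close> at the shifted
            vector.\<close>
          have Z'_m: "inner (Z' y) (0, m) = 0" for y
            using ran[of y] by (cases "Z' y") simp
          have "Z' (0, m) = 0"
            by (rule eq_zero_if_inner_zero) (simp add: Z'_m flip: positive_op_sym[OF Z'(1)])
          then have "Z' (x - (0, m)) = Z' x"
            using Z'(1) by (simp add: linear_diff bounded_clinear_linear positive_op_bounded)
          then have "inner (Z' x) x = inner (Z' (x - (0, m))) (x - (0, m))"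
            by (simp add: inner_diff_right Z'_m)
          also have "\<dots> \<le> inner (S (x - (0, m))) (x - (0, m))"
            using Z'(2) positive_op_nonneg[of "\<lambda>x. S x - Z' x" "x - (0, m)"]
            by (simp add: op_le_def inner_diff_left)
          also have "\<dots> = (norm (R (x - (0, m))))\<^sup>2"
            by (simp add: R_def norm_sqrt_op[OF S])
          also have "\<dots> = (norm (R x - f n))\<^sup>2"
            by (simp add: linear_diff[OF R_lin] m)
          finally show ?thesis .
        qed
        moreover have "(\<lambda>n. (norm (R x - f n))\<^sup>2) \<longlonglongrightarrow> (norm (R x - r))\<^sup>2"
          by (intro tendsto_intros f)
        ultimately have "inner (Z' x) x \<le> (norm (P (R x)))\<^sup>2"
          unfolding \<open>P (R x) = R x - r\<close> by (intro LIMSEQ_le_const) auto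
        then show ?thesis
          by (simp add: inner_diff_left Z_inner)
      qed
    qed
  qed
  have "shorted S fst_space = Z"
    unfolding shorted_def
  proof (rule the_equality)
    fix Z'
    assume "Z' \<in> shorted_candidates S fst_space \<and> (\<forall>Z''\<in>shorted_candidates S fst_space. op_le Z'' Z')"
    then show "Z' = Z"
      using Z_cand Z_max by (intro positive_op_antisym) auto
  qed (use Z_cand Z_max in blast)
  then show ?thesis
    using P Z unfolding Z_def R_def by (intro exI[of _ P]) auto
qed

text \<open>A preimage \<open>b\<close> of \<open>(g, 0)\<close> lies in the space onto which
  \<open>P\<close> projects, so \<open>inner (g, 0) z\<close> sees only
  \<open>P (sqrt_op S z)\<close>. The norm of this vector is that of the root of the shorted
  operator at \<open>z\<close>, and Douglas' criterion applies.\<close>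

lemma range_sqrt_op_fst_space_subset:
  assumes S: "positive_op S" and g: "(g, 0) \<in> range (sqrt_op S)"
  shows "(g, 0) \<in> range (sqrt_op (shorted S fst_space))"
proof -
  obtain b where b: "sqrt_op S b = (g, 0)"
    using g by (metis imageE)
  obtain P where P: "bounded_clinear P" "\<And>x. P x \<in> sqrt_op S -` fst_space"
      "\<And>x v. v \<in> sqrt_op S -` fst_space \<Longrightarrow> inner v (x - P x) = 0"
    and Z: "shorted S fst_space = (\<lambda>x. sqrt_op S (P (sqrt_op S x)))" "positive_op (shorted S fst_space)"
    using shorted_exists[OF S] by blast
  have sym: "inner (sqrt_op S x) y = inner x (sqrt_op S y)" for x y
    using S by (intro positive_op_sym positive_op_sqrt_op)
  show ?thesis
  proof (rule range_sqrt_opI[OF Z(2)])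
    fix z
    have "b \<in> sqrt_op S -` fst_space"
      by (simp add: b mem_fst_space_iff)
    then have "inner (g, 0) z = inner b (P (sqrt_op S z))"
      using P(3)[of b "sqrt_op S z"] by (simp add: inner_diff_right sym flip: b)
    then have "\<bar>inner (g, 0) z\<bar> \<le> norm b * norm (P (sqrt_op S z))"
      using Cauchy_Schwarz_ineq2 by metis
    also have "norm (P (sqrt_op S z)) = norm (sqrt_op (shorted S fst_space) z)"
    proof (rule power2_eq_imp_eq)
      have "inner (shorted S fst_space z) z = inner (P (sqrt_op S z)) (sqrt_op S z)"
        by (simp add: Z(1) sym)
      also have "\<dots> = inner (P (sqrt_op S z)) (P (sqrt_op S z))"
        using P(3)[OF P(2), of "sqrt_op S z" "sqrt_op S z"] by (simp add: inner_diff_right)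
      finally show "(norm (P (sqrt_op S z)))\<^sup>2 = (norm (sqrt_op (shorted S fst_space) z))\<^sup>2"
        by (simp add: norm_sqrt_op[OF Z(2)]) (simp add: power2_norm_eq_inner)
    qed simp_all
    finally show "\<bar>inner (g, 0) z\<bar> \<le> norm b * norm (sqrt_op (shorted S fst_space) z)" .
  qed simp
qed

lemma sqrt_op_zero: "sqrt_op (\<lambda>x. 0) = (\<lambda>x. 0)"
proof -
  have "positive_op (\<lambda>x::'a. 0::'a)"
    by (rule positive_opI) (simp_all add: bounded_clinear_zero)
  then show ?thesis
    by (intro sqrt_op_eqI) auto
qed

text \<open>For \<open>g\<close> of the overview, one membership comes from an explicit preimage
  (\<open>short_defect_rangeI'\<close>), the other only from domination of a functional; this is the
  test for the latter.\<close>

lemma short_defect_rangeI: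
  assumes "contraction S" and bound: "\<And>z. \<bar>inner (g, 0) z\<bar> \<le> c * norm (defect S z)" and "c \<ge> 0"
  shows "g \<in> short_defect_range S"
proof -
  note sq = positive_op_defect_sq[OF assms(1)]
  have "(g, 0) \<in> range (sqrt_op (defect_sq S))"
    using bound \<open>c \<ge> 0\<close> by (intro range_sqrt_opI[OF sq]) (simp_all add: defect_eq_sqrt_op[OF assms(1)])
  then show ?thesis
    unfolding short_defect_range_def using range_sqrt_op_fst_space_subset[OF sq] by (metis fst_conv image_eqI)
qed

lemma short_defect_rangeI':
  assumes "contraction S" and "defect S b = (g, 0)"
  shows "g \<in> short_defect_range S"
proof -
  have "(g, 0) \<in> range (sqrt_op (defect_sq S))"
    using assms by (metis defect_eq_sqrt_op rangeI)
  then show ?thesis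
    unfolding short_defect_range_def
    using range_sqrt_op_fst_space_subset[OF positive_op_defect_sq[OF assms(1)]]
    by (metis fst_conv image_eqI)
qed

text \<open>A vector of the first summand in the range of \<open>defect T\<close> lies in the range
  of the root of the short, which is zero.\<close>

lemma defect_eq_fst_imp_zero:
  assumes "contraction T" and "shorted (defect_sq T) fst_space = (\<lambda>_. 0)" and "defect T a = (e, 0)"
  shows "e = 0"
  using short_defect_rangeI'[OF assms(1,3)] assms(2) by (auto simp: short_defect_range_def sqrt_op_zero)


section \<open>Two steps of the system\<close>

lemma norm_snd_le: "norm (snd z) \<le> norm z"
  by (cases z) (simp add: norm_Pair)

lemma norm_snd_proj: "norm (snd_proj z) = norm (snd z)"
  by (cases z) (simp add: snd_proj_def norm_Pair)

lemma contraction_snd_proj_comp: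
  assumes "contraction T"
  shows "contraction (snd_proj \<circ> T)"
proof -
  note T = contraction_bounded_clinear[OF assms] and le = contraction_norm_le[OF assms]
  have snd_proj_eq: "snd_proj z = (0, snd z)" for z :: "'b \<times> 'c"
    by (cases z) (simp add: snd_proj_def)
  have "bounded_clinear (snd_proj :: 'b \<times> 'c \<Rightarrow> 'b \<times> 'c)"
  proof (rule bounded_clinearI)
    have "bounded_linear (\<lambda>z::'b \<times> 'c. (0::'b, snd z))"
      by (intro bounded_linear_Pair bounded_linear_zero bounded_linear_snd)
    then show "bounded_linear (snd_proj :: 'b \<times> 'c \<Rightarrow> 'b \<times> 'c)"
      by (simp add: snd_proj_eq[abs_def])
    show "snd_proj (\<i> *\<^sub>C x) = \<i> *\<^sub>C snd_proj x" for x :: "'b \<times> 'c"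
      using bounded_clinear_scaleC[OF bounded_clinear_zero] unfolding snd_proj_eq scaleC_prod_def
      by (metis fst_conv snd_conv)
  qed
  moreover have "norm (snd_proj (T x)) \<le> norm x" for x
    using norm_snd_le[of "T x"] le[of x] by (simp add: snd_proj_eq norm_Pair)
  ultimately show ?thesis
    using T by (simp add: contraction_def o_def bounded_clinear_compose)
qed

text \<open>\<open>u\<close> enters both defects and \<open>v\<close> only the second, so the sum is
  the squared distance between a fixed vector and a point of a linear manifold in a product space.
  It can be made small because the residue of the orthogonal projection vanishes.\<close>

lemma two_step_defect_small:
  fixes T :: "'h::complex_hilbert_space \<times> 'm::complex_hilbert_space \<Rightarrow>
      'h \<times> 'n::complex_hilbert_space"
  assumes T: "contraction T" and short: "shorted (defect_sq T) fst_space = (\<lambda>_. 0)"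
    and ranges: "short_defect_range (snd_proj \<circ> T) \<inter> short_defect_range (snd_proj \<circ> cadjoint T) = {0}"
    and "\<epsilon> > 0"
  obtains u v where
    "(norm (defect T (x, u)))\<^sup>2 + (norm (defect (snd_proj \<circ> T) (fst (T (x, u)), v)))\<^sup>2 < \<epsilon>"
proof -
  define S where "S = snd_proj \<circ> T"
  define S' where "S' = snd_proj \<circ> cadjoint T"
  have T': "contraction (cadjoint T)"
    using T by (rule contraction_cadjoint)
  have S: "contraction S" and S': "contraction S'"
    unfolding S_def S'_def using T T' by (simp_all only: contraction_snd_proj_comp)
  note T_bc = contraction_bounded_clinear[OF T] and T'_bc = contraction_bounded_clinear[OF T']
  note lin = bounded_clinear_linear[OF T_bc] bounded_clinear_linear[OF T'_bc]
    bounded_clinear_linear[OF positive_op_bounded[OF positive_op_defect[OF T]]]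
    bounded_clinear_linear[OF positive_op_bounded[OF positive_op_defect[OF S]]]
  note sym = positive_op_sym[OF positive_op_defect[OF T]] positive_op_sym[OF positive_op_defect[OF S]]
    positive_op_sym[OF positive_op_defect[OF T']]
  \<comment> \<open>\<open>L\<close> records both defects with second input 0, \<open>M\<close> the
    effect of the second input. \<open>V\<close> collects what the inputs alone produce from state
    0.\<close>
  define L where "L p = (defect T p, defect S (fst (T p), 0))" for p
  define M where "M v = (0::'h \<times> 'm, defect S (0, v))" for v
  define V where "V = range (\<lambda>(u, v). L (0, u) + M v)"
  have L_lin: "linear L"
    unfolding L_def
    by (intro linearI) (simp_all add: linear_add[OF lin(1)] linear_scale[OF lin(1)]
        linear_add[OF lin(3)] linear_scale[OF lin(3)] flip: linear_add[OF lin(4)] linear_scale[OF lin(4)])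
  have M_lin: "linear M"
    unfolding M_def
    by (intro linearI) (simp_all flip: linear_add[OF lin(4)] linear_scale[OF lin(4)])
  have "linear (\<lambda>(u, v). L (0, u) + M v)"
    using M_lin by (intro linearI)
      (auto simp: linear_add linear_scale scaleR_add_right simp flip: linear_add[OF L_lin] linear_scale[OF L_lin])
  then have "subspace V"
    unfolding V_def by (rule linear_subspace_image) simp
  then obtain r where r: "r \<in> closure V" and r_orth: "\<And>w. w \<in> V \<Longrightarrow> inner w (L (x, 0) - r) = 0"
    using orthogonal_projection_exists[of V "L (x, 0)"] by blast
  obtain a b where ab: "L (x, 0) - r = (a, b)"
    by (cases "L (x, 0) - r") auto
  \<comment> \<open>With the defects moved onto \<open>a\<close> and \<open>b\<close>, the choice
    \<open>u = 0\<close> isolates the second component of \<open>defect S b\<close>, and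
    \<open>v = 0\<close> that of \<open>w\<close>.\<close>
  have orth: "inner (0, u) (defect T a) + inner (fst (T (0, u)), v) (defect S b) = 0" for u v
  proof -
    have "L (0, u) + M v \<in> V"
      unfolding V_def by (rule range_eqI[of _ _ "(u, v)"]) simp
    from r_orth[OF this, unfolded ab] have "inner (defect T (0, u)) a + inner (defect S (fst (T (0, u)), v)) b = 0"
      by (simp add: L_def M_def flip: linear_add[OF lin(4)])
    then show ?thesis
      by (simp add: sym)
  qed
  have "snd (defect S b) = 0"
  proof (rule eq_zero_if_inner_zero)
    show "inner v (snd (defect S b)) = 0" for v
      using orth[of 0 v] linear_0[OF lin(1)] by (simp add: inner_prod_def zero_prod_def)
  qed
  then obtain g where g: "defect S b = (g, 0)"
    by (metis prod.collapse)
  define w where "w = defect T a + cadjoint T (g, 0)"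
  have "snd w = 0"
  proof (rule eq_zero_if_inner_zero)
    fix u
    have "inner (fst (T (0, u)), 0) (g, 0) = inner (0, u) (cadjoint T (g, 0))"
      by (simp add: inner_prod_def[of "T _"] flip: inner_cadjoint[OF T_bc])
    then have "inner (0, u) w = 0"
      using orth[of u 0] by (simp add: w_def g inner_add_right)
    then show "inner u (snd w) = 0"
      by (simp add: inner_prod_def)
  qed
  then obtain e where e: "w = (e, 0)"
    by (metis prod.collapse)
  \<comment> \<open>\<open>T\<close> is applied to \<open>w\<close>, and \<open>T T^*\<close> is
    replaced by the identity minus the squared defect of \<open>cadjoint T\<close>.\<close>
  have g_eq: "(g, 0) = T (e, 0) - T (defect T a) + defect (cadjoint T) (defect (cadjoint T) (g, 0))"
    by (simp add: w_def linear_add[OF lin(1)] defect_defect[OF T'] cadjoint_cadjoint[OF T_bc] flip: e)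
  have "g \<in> short_defect_range S'"
  proof (rule short_defect_rangeI[OF S'])
    fix z
    \<comment> \<open>\<open>N^2\<close> is the squared defect norm of \<open>cadjoint T\<close> at
      \<open>z\<close> plus the squared norm of the first component of \<open>cadjoint T z\<close>.
      Hence \<open>N\<close> dominates the three factors that \<open>g_eq\<close> produces when
      tested against \<open>z\<close>.\<close>
    define N where "N = norm (defect S' z)"
    have N_sq: "N\<^sup>2 = (norm z)\<^sup>2 - (norm (snd (cadjoint T z)))\<^sup>2"
      unfolding N_def norm_defect[OF S'] by (simp add: S'_def norm_snd_proj)
    have split: "(norm (cadjoint T z))\<^sup>2 = (norm (fst (cadjoint T z)))\<^sup>2 + (norm (snd (cadjoint T z)))\<^sup>2"
      by (cases "cadjoint T z") (simp add: norm_Pair)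
    have le: "norm (fst (cadjoint T z)) \<le> N" "norm (defect (cadjoint T) z) \<le> N"
      "norm (defect T (cadjoint T z)) \<le> N"
    proof -
      have nonneg: "(norm (cadjoint T z))\<^sup>2 \<le> (norm z)\<^sup>2"
        by (intro power_mono contraction_norm_le T') simp
      have "0 \<le> N"
        by (simp add: N_def)
      show "norm (fst (cadjoint T z)) \<le> N"
        using nonneg split N_sq by (intro power2_le_imp_le[OF _ \<open>0 \<le> N\<close>]) simp
      show *: "norm (defect (cadjoint T) z) \<le> N"
        using split N_sq by (intro power2_le_imp_le[OF _ \<open>0 \<le> N\<close>]) (simp add: norm_defect[OF T'])
      \<comment> \<open>Expanding \<open>|y - z|^2 >= 0\<close> gives
        \<open>|D_T T^* z| <= |D_{T^*} z|\<close> from norms alone, without the intertwining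
        relation of the two defects.\<close>
      define y where "y = T (cadjoint T z)"
      have "(norm (cadjoint T z))\<^sup>2 = inner y z"
        unfolding y_def by (simp add: inner_cadjoint[OF T_bc] power2_norm_eq_inner)
      moreover have "(norm (y - z))\<^sup>2 = (norm y)\<^sup>2 + (norm z)\<^sup>2 - 2 * inner y z"
        by (simp add: power2_norm_eq_inner inner_diff inner_commute)
      ultimately have "2 * (norm (cadjoint T z))\<^sup>2 \<le> (norm y)\<^sup>2 + (norm z)\<^sup>2"
        using zero_le_power2[of "norm (y - z)"] by linarith
      then have "(norm (defect T (cadjoint T z)))\<^sup>2 \<le> (norm (defect (cadjoint T) z))\<^sup>2"
        by (simp add: norm_defect[OF T] norm_defect[OF T'] y_def)
      then have "norm (defect T (cadjoint T z)) \<le> norm (defect (cadjoint T) z)"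
        by (rule power2_le_imp_le) simp
      then show "norm (defect T (cadjoint T z)) \<le> N"
        using * by simp
    qed
    have "inner (g, 0) z = inner e (fst (cadjoint T z)) - inner a (defect T (cadjoint T z))
        + inner (defect (cadjoint T) (g, 0)) (defect (cadjoint T) z)"
      by (subst g_eq) (simp add: inner_diff_left inner_add_left inner_cadjoint[OF T_bc] sym
          inner_prod_def[of "(e, 0)"])
    also have "\<bar>\<dots>\<bar> \<le> \<bar>inner e (fst (cadjoint T z))\<bar> + \<bar>inner a (defect T (cadjoint T z))\<bar>
        + \<bar>inner (defect (cadjoint T) (g, 0)) (defect (cadjoint T) z)\<bar>"
      by linarith
    also have "\<dots> \<le> norm e * N + norm a * N + norm (defect (cadjoint T) (g, 0)) * N"
      by (intro add_mono order_trans[OF Cauchy_Schwarz_ineq2] mult_left_mono le) simp_all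
    finally show "\<bar>inner (g, 0) z\<bar> \<le>
        (norm e + norm a + norm (defect (cadjoint T) (g, 0))) * norm (defect S' z)"
      by (simp add: N_def algebra_simps)
  qed simp
  moreover have "g \<in> short_defect_range S"
    using S g by (rule short_defect_rangeI')
  ultimately have "g = 0"
    using ranges unfolding S_def S'_def by blast
  then have "cadjoint T (g, 0) = 0"
    using linear_0[OF lin(2)] by (simp flip: zero_prod_def)
  then have "defect T a = (e, 0)"
    using e by (simp add: w_def)
  then have "e = 0"
    by (rule defect_eq_fst_imp_zero[OF T short])
  \<comment> \<open>Only \<open>defect T a = 0\<close> and \<open>defect S b = 0\<close> are known,
    and defects may have kernels. \<open>(a, b)\<close> vanishes because it is orthogonal to both
    \<open>L (x, 0)\<close> and \<open>r\<close>, whose difference it is.\<close>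
  have "inner (L (x, 0)) (a, b) = 0"
    using \<open>defect T a = (e, 0)\<close> \<open>e = 0\<close> \<open>g = 0\<close> g by (simp add: L_def sym)
  moreover have "inner r (a, b) = 0"
  proof -
    obtain s where s: "\<And>n. s n \<in> V" "s \<longlonglongrightarrow> r"
      using r unfolding closure_sequential by blast
    have "(\<lambda>n. inner (s n) (a, b)) \<longlonglongrightarrow> inner r (a, b)"
      by (intro tendsto_intros s)
    moreover have "inner (s n) (a, b) = 0" for n
      using r_orth[OF s(1)] ab by simp
    ultimately show ?thesis
      by (simp add: LIMSEQ_const_iff)
  qed
  ultimately have "inner (a, b) (a, b) = 0"
    by (simp add: inner_diff_left flip: ab)
  then have "(a, b) = 0"
    by (simp only: inner_eq_zero_iff)
  then have "L (x, 0) \<in> closure V"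
    using r ab by simp
  moreover have "sqrt \<epsilon> > 0"
    using \<open>\<epsilon> > 0\<close> by simp
  ultimately obtain w' where w': "w' \<in> V" "dist w' (L (x, 0)) < sqrt \<epsilon>"
    unfolding closure_approachable by blast
  then obtain u v where uv: "w' = L (0, u) + M v"
    by (auto simp: V_def)
  \<comment> \<open>The inputs of the approximant are subtracted, so the required ones are
    \<open>- u\<close> and \<open>- v\<close>.\<close>
  have "L (x, 0) - w' = (defect T (x, - u), defect S (fst (T (x, - u)), - v))"
  proof -
    have "L (x, 0) - L (0, u) = L (x, - u)"
      by (simp flip: linear_diff[OF L_lin])
    moreover have "L (x, - u) - M v = (defect T (x, - u), defect S (fst (T (x, - u)), - v))"
      by (simp add: L_def M_def flip: linear_diff[OF lin(4)])
    ultimately show ?thesis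
      by (simp only: uv diff_diff_eq[symmetric])
  qed
  then have "(norm (defect T (x, - u)))\<^sup>2 + (norm (defect S (fst (T (x, - u)), - v)))\<^sup>2
      = (dist w' (L (x, 0)))\<^sup>2"
    by (subst dist_commute) (simp add: dist_norm norm_Pair)
  also have "\<dots> < \<epsilon>"
    using w'(2) \<open>\<epsilon> > 0\<close> by (metis dist_norm norm_ge_zero power_strict_mono pos2 real_sqrt_pow2 less_imp_le)
  finally show ?thesis
    using that by (simp add: S_def)
qed

text \<open>\<open>|y|^2\<close> cancels between the two defects and \<open>\<phi> y\<close> between
  the two dissipation inequalities. \<open>K\<close> is the set on which \<open>\<phi>\<close> is
  meaningful, later the domain or the range of an unbounded root.\<close>

lemma storage_ge_norm_sq:
  fixes T :: "'h::complex_hilbert_space \<times> 'm::complex_hilbert_space \<Rightarrow>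
      'h \<times> 'n::complex_hilbert_space"
  assumes T: "contraction T" and short: "shorted (defect_sq T) fst_space = (\<lambda>_. 0)"
    and ranges: "short_defect_range (snd_proj \<circ> T) \<inter> short_defect_range (snd_proj \<circ> cadjoint T) = {0}"
    and invariant: "\<And>x u. x \<in> K \<Longrightarrow> fst (T (x, u)) \<in> K"
    and dissipative: "\<And>x u. x \<in> K \<Longrightarrow>
      \<phi> (fst (T (x, u))) + (norm (snd (T (x, u))))\<^sup>2 \<le> \<phi> x + (norm u)\<^sup>2"
    and nonneg: "\<And>x. x \<in> K \<Longrightarrow> 0 \<le> \<phi> x"
    and "x \<in> K"
  shows "(norm x)\<^sup>2 \<le> \<phi> x"
proof (rule field_le_epsilon)
  fix \<epsilon> :: real
  assume "\<epsilon> > 0"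
  then obtain u v where small:
    "(norm (defect T (x, u)))\<^sup>2 + (norm (defect (snd_proj \<circ> T) (fst (T (x, u)), v)))\<^sup>2 < \<epsilon>"
    using two_step_defect_small[OF T short ranges] by blast
  define y where "y = fst (T (x, u))"
  have "y \<in> K"
    unfolding y_def using \<open>x \<in> K\<close> by (rule invariant)
  \<comment> \<open>The storage remaining after the second step is estimated below by 0, so no third
    step arises.\<close>
  have "(norm (snd (T (y, v))))\<^sup>2 \<le> \<phi> y + (norm v)\<^sup>2"
    using dissipative[OF \<open>y \<in> K\<close>, of v] nonneg[OF invariant[OF \<open>y \<in> K\<close>, of v]] by simp
  moreover have "\<phi> y + (norm (snd (T (x, u))))\<^sup>2 \<le> \<phi> x + (norm u)\<^sup>2"
    unfolding y_def using \<open>x \<in> K\<close> by (rule dissipative)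
  moreover have "(norm (defect T (x, u)))\<^sup>2 =
      (norm x)\<^sup>2 + (norm u)\<^sup>2 - (norm y)\<^sup>2 - (norm (snd (T (x, u))))\<^sup>2"
    by (cases "T (x, u)") (simp add: norm_defect[OF T] norm_Pair y_def)
  moreover have "(norm (defect (snd_proj \<circ> T) (y, v)))\<^sup>2 =
      (norm y)\<^sup>2 + (norm v)\<^sup>2 - (norm (snd (T (y, v))))\<^sup>2"
    by (simp add: norm_defect[OF contraction_snd_proj_comp[OF T]] norm_snd_proj norm_Pair)
  ultimately show "(norm x)\<^sup>2 \<le> \<phi> x + \<epsilon>"
    using small by (simp flip: y_def)
qed


section \<open>Square roots of unbounded operators\<close>

lemma mem_graph_iff: "(x, y) \<in> Map.graph X \<longleftrightarrow> X x = Some y"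
  by (simp add: graph_def)

lemma
  assumes "linear_operator X"
  shows linear_operator_zero: "X 0 = Some 0"
    and linear_operator_add: "X x = Some x' \<Longrightarrow> X y = Some y' \<Longrightarrow> X (x + y) = Some (x' + y')"
    and linear_operator_scaleC: "X x = Some x' \<Longrightarrow> X (c *\<^sub>C x) = Some (c *\<^sub>C x')"
    and linear_operator_scaleR: "X x = Some x' \<Longrightarrow> X (r *\<^sub>R x) = Some (r *\<^sub>R x')"
    and linear_operator_diff: "X x = Some x' \<Longrightarrow> X y = Some y' \<Longrightarrow> X (x - y) = Some (x' - y')"
proof -
  have G: "(0, 0) \<in> Map.graph X" "\<And>z w. z \<in> Map.graph X \<Longrightarrow> w \<in> Map.graph X \<Longrightarrow> z + w \<in> Map.graph X"
      "\<And>c z. z \<in> Map.graph X \<Longrightarrow> c *\<^sub>C z \<in> Map.graph X"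
    using assms unfolding linear_operator_def csubspace_def by (auto simp: zero_prod_def)
  show zero: "X 0 = Some 0"
    using G(1) by (simp add: mem_graph_iff)
  show add: "X (x + y) = Some (x' + y')" if "X x = Some x'" "X y = Some y'" for x y x' y'
    using G(2)[of "(x, x')" "(y, y')"] that by (simp add: mem_graph_iff)
  show scaleC: "X (c *\<^sub>C x) = Some (c *\<^sub>C x')" if "X x = Some x'" for c x x'
    using G(3)[of "(x, x')" c] that by (simp add: mem_graph_iff scaleC_prod_def)
  show scaleR: "X (r *\<^sub>R x) = Some (r *\<^sub>R x')" if "X x = Some x'" for r x x'
    using scaleC[OF that, of "complex_of_real r"] by (simp add: scaleC_of_real)
  show "X (x - y) = Some (x' - y')" if "X x = Some x'" "X y = Some y'" for x y x' y'
    using add[OF that(1) scaleR[OF that(2), of "-1"]] by simp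
qed

text \<open>The domain is complex linear, so the real identity at \<open>\<i>\<close> times
  \<open>x\<close> supplies the imaginary part of the complex one.\<close>

lemma selfadjoint_iff:
  "selfadjoint X \<longleftrightarrow> linear_operator X \<and> closure (dom X) = UNIV \<and>
    (\<forall>y z. X y = Some z \<longleftrightarrow> (\<forall>x x'. X x = Some x' \<longrightarrow> inner x' y = inner x z))"
proof -
  have "(\<forall>x\<in>dom X. cinner (the (X x)) y = cinner x z) \<longleftrightarrow>
      (\<forall>x x'. X x = Some x' \<longrightarrow> inner x' y = inner x z)" (is "?L \<longleftrightarrow> ?R")
    if X: "linear_operator X" for y z
  proof
    assume ?L
    then show ?R
      by (auto simp: inner_eq_Re_cinner dom_def)
  next
    assume R: ?R
    show ?L
    proof
      fix x
      assume "x \<in> dom X"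
      then obtain x' where x': "X x = Some x'"
        by blast
      have "inner x' y = inner x z" "inner (\<i> *\<^sub>C x') y = inner (\<i> *\<^sub>C x) z"
        using R x' linear_operator_scaleC[OF X x'] by blast+
      then have "cinner x' y = cinner x z"
        by (intro complex_eqI) (simp_all add: inner_scaleC_i Im_cinner flip: inner_eq_Re_cinner)
      then show "cinner (the (X x)) y = cinner x z"
        by (simp add: x')
    qed
  qed
  then show ?thesis
    unfolding selfadjoint_def by blast
qed

lemma selfadjoint_linear: "selfadjoint X \<Longrightarrow> linear_operator X"
  by (simp add: selfadjoint_def)

lemma selfadjoint_inner:
  "selfadjoint X \<Longrightarrow> X x = Some x' \<Longrightarrow> X y = Some y' \<Longrightarrow> inner x' y = inner x y'"
  unfolding selfadjoint_iff by blast

lemma selfadjointD: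
  assumes "selfadjoint X" and "\<And>x x'. X x = Some x' \<Longrightarrow> inner x' y = inner x z"
  shows "X y = Some z"
  using assms unfolding selfadjoint_iff by blast

lemma nonneg_selfadjoint_inner:
  assumes "nonneg_selfadjoint X" "X x = Some x'"
  shows "0 \<le> inner x' x"
proof -
  have "0 \<le> cinner (the (X x)) x"
    using assms unfolding nonneg_selfadjoint_def by blast
  then show ?thesis
    using assms(2) by (simp add: less_eq_complex_def inner_eq_Re_cinner)
qed

lemma nonneg_selfadjointI:
  assumes X: "selfadjoint X" and nonneg: "\<And>x x'. X x = Some x' \<Longrightarrow> 0 \<le> inner x' x"
  shows "nonneg_selfadjoint X"
  unfolding nonneg_selfadjoint_def
proof (intro conjI ballI X)
  fix x
  assume "x \<in> dom X"
  then obtain x' where x': "X x = Some x'"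
    by blast
  have "X (\<i> *\<^sub>C x) = Some (\<i> *\<^sub>C x')"
    using linear_operator_scaleC[OF selfadjoint_linear[OF X] x'] .
  then have "inner x' (\<i> *\<^sub>C x) = inner x (\<i> *\<^sub>C x')"
    using selfadjoint_inner[OF X x'] by blast
  also have "\<dots> = - inner x' (\<i> *\<^sub>C x)"
    by (metis inner_commute inner_scaleC_i)
  finally have "Im (cinner x' x) = 0"
    by (simp add: Im_cinner)
  then show "0 \<le> cinner (the (X x)) x"
    using nonneg[OF x'] by (simp add: x' less_eq_complex_def inner_eq_Re_cinner)
qed

lemma map_comp_eq_Some_iff: "(R \<circ>\<^sub>m S) x = Some z \<longleftrightarrow> (\<exists>y. S x = Some y \<and> R y = Some z)"
  by (cases "S x") simp_all

text \<open>The range of \<open>I + X\<close> is dense, since a vector orthogonal to it would be an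
  eigenvector of \<open>X\<close> for \<open>-1\<close>. It is closed, since
  \<open>|p| <= |(I + X) p|\<close> and \<open>X\<close> is closed.\<close>

lemma resolvent_exists:
  assumes X: "nonneg_selfadjoint X"
  shows "\<exists>y y'. X y = Some y' \<and> y + y' = z"
proof -
  have sa: "selfadjoint X"
    using X by (simp add: nonneg_selfadjoint_def)
  note lin = selfadjoint_linear[OF sa]
  define V where "V = {y + y' | y y'. X y = Some y'}"
  have "subspace V"
    unfolding subspace_def
  proof (intro conjI ballI allI)
    show "0 \<in> V"
      unfolding V_def using linear_operator_zero[OF lin] by force
    show "a + b \<in> V" if ab: "a \<in> V" "b \<in> V" for a b
    proof -
      obtain x x' y y' where "X x = Some x'" "a = x + x'" "X y = Some y'" "b = y + y'"
        using ab unfolding V_def by blast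
      then show ?thesis
        using linear_operator_add[OF lin, of x x' y y'] unfolding V_def
        by (intro CollectI exI[of _ "x + y"] exI[of _ "x' + y'"]) simp
    qed
    show "r *\<^sub>R a \<in> V" if a: "a \<in> V" for r a
    proof -
      obtain x x' where "X x = Some x'" "a = x + x'"
        using a by (auto simp: V_def)
      then show ?thesis
        using linear_operator_scaleR[OF lin, of x x' r] unfolding V_def
        by (intro CollectI exI[of _ "r *\<^sub>R x"] exI[of _ "r *\<^sub>R x'"]) (simp add: scaleR_add_right)
    qed
  qed
  then obtain v where v: "v \<in> closure V" "\<And>w. w \<in> V \<Longrightarrow> inner w (z - v) = 0"
    using orthogonal_projection_exists by blast
  have "X (z - v) = Some (- (z - v))"
  proof (rule selfadjointD[OF sa])
    fix x x'
    assume "X x = Some x'"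
    then have "inner (x + x') (z - v) = 0"
      by (intro v(2)) (auto simp: V_def)
    then show "inner x' (z - v) = inner x (- (z - v))"
      by (simp add: inner_add_left inner_diff_right)
  qed
  then have "0 \<le> inner (- (z - v)) (z - v)"
    by (rule nonneg_selfadjoint_inner[OF X])
  then have "inner (z - v) (z - v) \<le> 0"
    by (simp only: inner_minus_left neg_0_le_iff_le)
  then have "inner (z - v) (z - v) = 0"
    using inner_ge_zero[of "z - v"] by (rule antisym)
  then have "z = v"
    by simp
  obtain s where s: "\<And>n. s n \<in> V" "s \<longlonglongrightarrow> v"
    using v(1) unfolding closure_sequential by blast
  then have "\<forall>n. \<exists>y y'. X y = Some y' \<and> s n = y + y'"
    unfolding V_def by blast
  then obtain p p' where p: "\<And>n. X (p n) = Some (p' n)" "\<And>n. s n = p n + p' n"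
    by metis
  have "dist (p m) (p n) \<le> dist (s m) (s n)" for m n
  proof -
    have "X (p m - p n) = Some (p' m - p' n)"
      using p(1) linear_operator_diff[OF lin] by blast
    then have "0 \<le> inner (p' m - p' n) (p m - p n)"
      by (rule nonneg_selfadjoint_inner[OF X])
    moreover have "(norm (s m - s n))\<^sup>2 = (norm (p m - p n))\<^sup>2 + 2 * inner (p' m - p' n) (p m - p n)
        + (norm (p' m - p' n))\<^sup>2"
      by (simp add: p(2) power2_norm_eq_inner inner_add inner_diff inner_commute algebra_simps)
    ultimately have "(norm (p m - p n))\<^sup>2 \<le> (norm (s m - s n))\<^sup>2"
      by (simp add: add_increasing2)
    then show ?thesis
      unfolding dist_norm by (rule power2_le_imp_le) simp
  qed
  then have "Cauchy p"
    using LIMSEQ_imp_Cauchy[OF s(2)] unfolding Cauchy_def by (meson order_le_less_trans)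
  then obtain y where y: "p \<longlonglongrightarrow> y"
    using Cauchy_convergent convergent_def by blast
  have p'_lim: "p' \<longlonglongrightarrow> v - y"
    using tendsto_diff[OF s(2) y] by (simp add: p(2))
  \<comment> \<open>Selfadjointness serves as closedness: the relation characterising the graph
    passes to the limit.\<close>
  have "X y = Some (v - y)"
  proof (rule selfadjointD[OF sa])
    fix x x'
    assume x: "X x = Some x'"
    have "(\<lambda>n. inner x' (p n)) \<longlonglongrightarrow> inner x' y" "(\<lambda>n. inner x (p' n)) \<longlonglongrightarrow> inner x (v - y)"
      by (intro tendsto_intros y p'_lim)+
    moreover have "inner x' (p n) = inner x (p' n)" for n
      using selfadjoint_inner[OF sa x p(1)] .
    ultimately show "inner x' y = inner x (v - y)"
      using LIMSEQ_unique by simp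
  qed
  then show ?thesis
    using \<open>z = v\<close> by (intro exI[of _ y] exI[of _ "v - y"]) simp
qed

text \<open>\<open>G = (I + X)^{-1}\<close>. The graph of \<open>X\<close> consists of the pairs
  \<open>(G z, z - G z)\<close>, so \<open>X\<close> is encoded by one bounded operator between 0
  and \<open>I\<close>, accessible to the bounded theory.\<close>

lemma resolvent_op_exists:
  assumes X: "nonneg_selfadjoint X"
  shows "\<exists>G. positive_op G \<and> positive_op (\<lambda>z. z - G z) \<and>
    (\<forall>y z. G z = y \<longleftrightarrow> X y = Some (z - y))"
proof -
  have sa: "selfadjoint X"
    using X by (simp add: nonneg_selfadjoint_def)
  note lin = selfadjoint_linear[OF sa]
  have "\<exists>y. X y = Some (z - y)" for z
    using resolvent_exists[OF X, of z] by (metis add_diff_cancel_left')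
  then obtain G where G: "\<And>z. X (G z) = Some (z - G z)"
    by metis
  have uniq: "y = G z" if "X y = Some (z - y)" for y z
  proof -
    have "X (y - G z) = Some (z - y - (z - G z))"
      using linear_operator_diff[OF lin that G] .
    then have "0 \<le> inner (z - y - (z - G z)) (y - G z)"
      by (rule nonneg_selfadjoint_inner[OF X])
    then have "0 \<le> - inner (y - G z) (y - G z)"
      by (simp add: inner_diff)
    then show ?thesis
      using inner_ge_zero[of "y - G z"] by simp
  qed
  have mono: "(norm (G z))\<^sup>2 \<le> inner (G z) z" for z
    using nonneg_selfadjoint_inner[OF X G, of z]
    by (simp add: inner_diff power2_norm_eq_inner inner_commute)
  have "bounded_clinear G"
  proof (intro bounded_clinearI bounded_linear_intro)
    show "G (x + y) = G x + G y" for x y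
      using linear_operator_add[OF lin G G, of x y] by (intro uniq[symmetric]) (simp add: algebra_simps)
    show "G (r *\<^sub>R x) = r *\<^sub>R G x" for r x
      using linear_operator_scaleR[OF lin G, of r x] by (intro uniq[symmetric]) (simp add: algebra_simps)
    show "G (\<i> *\<^sub>C x) = \<i> *\<^sub>C G x" for x
      using linear_operator_scaleC[OF lin G, of \<i> x]
      by (intro uniq[symmetric]) (simp add: scaleC_diff_right)
    show "norm (G x) \<le> norm x * 1" for x
    proof -
      have "norm (G x) * norm (G x) \<le> norm (G x) * norm x"
        using mono[of x] norm_cauchy_schwarz[of "G x" x] by (simp add: power2_eq_square)
      then show ?thesis
        by (cases "G x = 0") auto
    qed
  qed
  have G_sym: "inner (G x) y = inner x (G y)" for x y
    using selfadjoint_inner[OF sa G G, of x y] by (simp add: inner_diff)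
  have "positive_op G"
    using \<open>bounded_clinear G\<close> G_sym
    by (rule positive_opI) (metis mono order_trans zero_le_power2)
  moreover have "positive_op (\<lambda>z. z - G z)"
  proof (rule positive_opI)
    show "bounded_clinear (\<lambda>z. z - G z)"
      by (intro bounded_clinear_intros \<open>bounded_clinear G\<close>)
    show "inner (x - G x) y = inner x (y - G y)" for x y
      by (simp add: inner_diff G_sym)
    show "0 \<le> inner (z - G z) z" for z
    proof -
      have "0 \<le> (norm (z - G z))\<^sup>2"
        by simp
      also have "\<dots> = inner (z - G z) z - (inner (G z) z - (norm (G z))\<^sup>2)"
        by (simp add: power2_norm_eq_inner inner_diff inner_commute)
      finally show ?thesis
        using mono[of z] by linarith
    qed
  qed
  ultimately show ?thesis
    using G uniq by blast
qed

lemma linear_operatorI: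
  assumes "X 0 = Some 0" and "\<And>x y x' y'. X x = Some x' \<Longrightarrow> X y = Some y' \<Longrightarrow> X (x + y) = Some (x' + y')"
    and "\<And>c x x'. X x = Some x' \<Longrightarrow> X (c *\<^sub>C x) = Some (c *\<^sub>C x')"
  shows "linear_operator X"
  unfolding linear_operator_def csubspace_def using assms
  by (auto simp: mem_graph_iff zero_prod_def scaleC_prod_def)

text \<open>Formally \<open>X = (I - G) G^{-1}\<close>, so the root is \<open>Q P^{-1}\<close> with
  \<open>P\<close> and \<open>Q\<close> the roots of \<open>G\<close> and \<open>I - G\<close>. The
  proof runs on \<open>P Q = Q P\<close> and \<open>P^2 + Q^2 = I\<close>.\<close>

lemma sqrt_operator_exists:
  assumes X: "nonneg_selfadjoint X"
  shows "\<exists>R. nonneg_selfadjoint R \<and> R \<circ>\<^sub>m R = X"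
proof -
  obtain G where G: "positive_op G" and G': "positive_op (\<lambda>z. z - G z)"
    and G_iff: "\<And>y z. G z = y \<longleftrightarrow> X y = Some (z - y)"
    using resolvent_op_exists[OF X] by blast
  define P where "P = sqrt_op G"
  define Q where "Q = sqrt_op (\<lambda>z. z - G z)"
  have P: "positive_op P" and PP: "\<And>z. P (P z) = G z"
    unfolding P_def using G by (simp_all add: positive_op_sqrt_op sqrt_op_sqrt_op)
  have Q: "positive_op Q" and QQ: "\<And>z. Q (Q z) = z - G z"
    unfolding Q_def using positive_op_sqrt_op[OF G'] sqrt_op_sqrt_op[OF G'] by simp_all
  note P_bc = positive_op_bounded[OF P] and Q_bc = positive_op_bounded[OF Q]
  note P_lin = bounded_clinear_linear[OF P_bc] and Q_lin = bounded_clinear_linear[OF Q_bc]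
  note P_sym = positive_op_sym[OF P] and Q_sym = positive_op_sym[OF Q]
  have PQ: "P (Q z) = Q (P z)" for z
  proof -
    have "P (x - G x) = P x - G (P x)" for x
      by (simp add: linear_diff[OF P_lin] flip: PP)
    then show ?thesis
      unfolding Q_def by (rule sqrt_op_commute[OF G' positive_op_bounded_linear[OF P]])
  qed
  have PPQQ: "P (P z) + Q (Q z) = z" for z
    by (simp add: PP QQ)
  have "inj P"
  proof (rule linear_injective_0[OF P_lin, THEN iffD2], intro allI impI)
    fix z
    assume "P z = 0"
    then have "G z = 0"
      using linear_0[OF P_lin] by (simp flip: PP)
    then have "X 0 = Some z"
      by (simp add: G_iff)
    moreover have "X 0 = Some 0"
      using X linear_operator_zero selfadjoint_linear unfolding nonneg_selfadjoint_def by blast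
    ultimately show "z = 0"
      by simp
  qed
  define R where "R y = (if y \<in> range P then Some (Q (inv P y)) else None)" for y
  have R_iff: "R y = Some z \<longleftrightarrow> (\<exists>w. y = P w \<and> z = Q w)" for y z
    unfolding R_def using \<open>inj P\<close> by auto
  have R_lin: "linear_operator R"
  proof (rule linear_operatorI)
    show "R 0 = Some 0"
      unfolding R_iff using linear_0[OF P_lin] linear_0[OF Q_lin] by metis
    show "R (x + y) = Some (x' + y')" if "R x = Some x'" "R y = Some y'" for x x' y y'
      using that unfolding R_iff by (metis linear_add P_lin Q_lin)
    show "R (c *\<^sub>C x) = Some (c *\<^sub>C x')" if "R x = Some x'" for c x x'
      using that unfolding R_iff by (metis bounded_clinear_scaleC P_bc Q_bc)
  qed
  have "selfadjoint R"
    unfolding selfadjoint_iff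
  proof (intro conjI allI iffI impI R_lin)
    have "dom R = range P"
      by (auto simp: R_def split: if_splits)
    moreover have "y \<in> closure (range P)" for y
    proof -
      have "subspace (range P)"
        using P_lin by (rule linear_subspace_image) simp
      then obtain v where v: "v \<in> closure (range P)" "\<And>x. x \<in> range P \<Longrightarrow> inner x (y - v) = 0"
        using orthogonal_projection_exists by blast
      have "inner x (P (y - v)) = 0" for x
        using v(2)[of "P x"] by (simp add: P_sym)
      then have "P (y - v) = P 0"
        using eq_zero_if_inner_zero linear_0[OF P_lin] by metis
      then show ?thesis
        using v(1) injD[OF \<open>inj P\<close>, of "y - v" 0] by simp
    qed
    ultimately show "closure (dom R) = UNIV"
      by auto
  next
    fix y z x x'
    assume "R y = Some z" "R x = Some x'"
    then obtain v w where "y = P w" "z = Q w" "x = P v" "x' = Q v"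
      unfolding R_iff by blast
    then show "inner x' y = inner x z"
      by (simp add: P_sym Q_sym PQ)
  next
    fix y z
    assume *: "\<forall>x x'. R x = Some x' \<longrightarrow> inner x' y = inner x z"
    have "Q y = P z"
    proof (rule eq_if_inner_eq)
      fix w
      have "inner (Q w) y = inner (P w) z"
        using * unfolding R_iff by blast
      then show "inner w (Q y) = inner w (P z)"
        by (simp add: P_sym Q_sym)
    qed
    \<comment> \<open>By \<open>P^2 + Q^2 = I\<close> this \<open>w\<close> solves
      \<open>P w = y\<close> and \<open>Q w = z\<close> at once, so \<open>y\<close> lies in the
      domain: the adjoint of \<open>R\<close> does not extend \<open>R\<close> properly.\<close>
    define w where "w = P y + Q z"
    have "P w = P (P y) + Q (P z)"
      by (simp add: w_def linear_add[OF P_lin] PQ)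
    then have "P w = y"
      by (simp add: PPQQ flip: \<open>Q y = P z\<close>)
    moreover have "Q w = P (Q y) + Q (Q z)"
      by (simp add: w_def linear_add[OF Q_lin] PQ)
    then have "Q w = z"
      by (simp add: PPQQ \<open>Q y = P z\<close>)
    ultimately show "R y = Some z"
      unfolding R_iff by blast
  qed
  then have "nonneg_selfadjoint R"
  proof (rule nonneg_selfadjointI)
    fix x x'
    assume "R x = Some x'"
    then obtain w where "x = P w" "x' = Q w"
      unfolding R_iff by blast
    then have "inner x' x = inner (P (Q w)) w"
      by (simp add: P_sym)
    then show "0 \<le> inner x' x"
      using positive_op_nonneg[OF positive_op_compose_commute[OF P Q PQ]] by simp
  qed
  moreover have "R \<circ>\<^sub>m R = X"
  proof -
    have "(R \<circ>\<^sub>m R) y = Some z \<longleftrightarrow> X y = Some z" for y z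
    proof
      assume "(R \<circ>\<^sub>m R) y = Some z"
      then obtain v w where v: "y = P v" "Q v = P w" "z = Q w"
        unfolding map_comp_eq_Some_iff R_iff by auto
      have "G (P v + Q w) = y"
      proof -
        have "P (P v + Q w) = P (P v) + Q (P w)"
          by (simp add: linear_add[OF P_lin] PQ)
        then have "P (P v + Q w) = v"
          by (simp add: PPQQ flip: v(2))
        then show ?thesis
          by (simp add: v(1) flip: PP)
      qed
      then show "X y = Some z"
        using G_iff[of "P v + Q w" y] v by simp
    next
      assume "X y = Some z"
      then have Gy: "G (y + z) = y"
        by (simp add: G_iff)
      have "R y = Some (Q (P (y + z)))"
        unfolding R_iff using Gy by (intro exI[of _ "P (y + z)"]) (simp add: PP)
      moreover have "R (Q (P (y + z))) = Some z"
        unfolding R_iff using Gy by (intro exI[of _ "Q (y + z)"]) (simp add: PQ QQ)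
      ultimately show "(R \<circ>\<^sub>m R) y = Some z"
        by (simp add: map_comp_eq_Some_iff)
    qed
    then show ?thesis
      by (intro ext) (metis not_Some_eq)
  qed
  ultimately show ?thesis
    by blast
qed

text \<open>If \<open>G = (I + X)\<^sup>-\<^sup>1\<close>, then \<open>R G\<close> is the bounded root of \<open>G - G\<^sup>2\<close>, and it determines \<open>R\<close>.\<close>

lemma sqrt_operator_graph:
  assumes X: "nonneg_selfadjoint X" and R: "nonneg_selfadjoint R" "R \<circ>\<^sub>m R = X"
    and G: "positive_op G" and G_iff: "\<And>y z. G z = y \<longleftrightarrow> X y = Some (z - y)"
  shows "R y = Some z \<longleftrightarrow> G z = sqrt_op (\<lambda>x. G x - G (G x)) y"
proof -
  have sa: "selfadjoint R"
    using R(1) by (simp add: nonneg_selfadjoint_def)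
  note R_lin = selfadjoint_linear[OF sa]
  have "\<exists>k. R (G z) = Some k \<and> R k = Some (z - G z)" for z
    using G_iff[of z "G z"] unfolding R(2)[symmetric] map_comp_eq_Some_iff by simp
  then obtain K where K: "\<And>z. R (G z) = Some (K z)" "\<And>z. R (K z) = Some (z - G z)"
    by metis
  note G_bc = positive_op_bounded[OF G]
  note G_lin = bounded_clinear_linear[OF G_bc]
  have G_eqI: "G x = y" if "R y = Some k" "R k = Some (x - y)" for x y k
    using that G_iff[of x y] unfolding R(2)[symmetric] map_comp_eq_Some_iff by blast
  have K_eq: "K x = k" if "R (G x) = Some k" for x k
    using that K(1) by simp
  \<comment> \<open>\<open>G\<close> commutes with \<open>R\<close>: applying \<open>R\<close> to
    \<open>R (K y) = y - G y\<close> gives \<open>X (K y) = z - K y\<close>, that is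
    \<open>(I + X) (K y) = z\<close>.\<close>
  have GR: "R (G y) = Some (G z)" if "R y = Some z" for y z
  proof -
    have "R (y - G y) = Some (z - K y)"
      using linear_operator_diff[OF R_lin that K(1)] .
    then have "G z = K y"
      using K(2)[of y] by (intro G_eqI[of _ "y - G y"])
    then show ?thesis
      using K(1) by simp
  qed
  have K_sq: "K (K z) = G z - G (G z)" for z
  proof -
    have "R (G (K z)) = Some (G (z - G z))"
      using GR[OF K(2)] .
    then show ?thesis
      by (simp add: K_eq linear_diff[OF G_lin])
  qed
  have K_inner: "inner (K x) y = inner x (K y)" for x y
  proof -
    have "inner (K x) y = inner (K x) (G y) + inner (K x) (y - G y)"
      by (simp add: inner_diff_right)
    also have "inner (K x) (G y) = inner (G x) (K y)"
      by (rule selfadjoint_inner[OF sa K(1) K(1)])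
    also have "inner (K x) (y - G y) = inner (x - G x) (K y)"
      by (rule selfadjoint_inner[OF sa K(2) K(2), symmetric])
    finally show ?thesis
      by (simp add: inner_diff_left)
  qed
  have K_norm: "(norm (K z))\<^sup>2 \<le> (norm z)\<^sup>2" for z
  proof -
    have "(norm (K z))\<^sup>2 = inner z (G z) - inner (G z) (G z)"
      unfolding power2_norm_eq_inner
      by (simp add: K_inner K_sq inner_diff_right positive_op_sym[OF G])
    also have "\<dots> \<le> inner z z"
    proof -
      have "0 \<le> inner (z - G z) (z - G z) + inner (G z) z"
        using positive_op_nonneg[OF G] by (intro add_nonneg_nonneg inner_ge_zero)
      then show ?thesis
        by (simp add: inner_diff inner_commute)
    qed
    finally show ?thesis
      by (simp add: power2_norm_eq_inner)
  qed
  have "positive_op K"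
  proof (rule positive_opI)
    show "bounded_clinear K"
    proof (intro bounded_clinearI bounded_linear_intro)
      show "K (x + y) = K x + K y" for x y
        using linear_operator_add[OF R_lin K(1) K(1), of x y]
        by (intro K_eq) (simp add: linear_add[OF G_lin])
      show "K (r *\<^sub>R x) = r *\<^sub>R K x" for r x
        using linear_operator_scaleR[OF R_lin K(1), of r x]
        by (intro K_eq) (simp add: linear_scale[OF G_lin])
      show "K (\<i> *\<^sub>C x) = \<i> *\<^sub>C K x" for x
        using linear_operator_scaleC[OF R_lin K(1), of \<i> x]
        by (intro K_eq) (simp add: bounded_clinear_scaleC[OF G_bc])
      show "norm (K x) \<le> norm x * 1" for x
        using power2_le_imp_le[OF K_norm] by simp
    qed
    show "inner (K x) y = inner x (K y)" for x y
      by (rule K_inner)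
    show "0 \<le> inner (K x) x" for x
    proof -
      \<comment> \<open>\<open>x\<close> is split into \<open>G x\<close> and
        \<open>x - G x = R (K x)\<close>; the two terms are the form of \<open>R\<close> at
        \<open>G x\<close> and at \<open>K x\<close>.\<close>
      have "0 \<le> inner (K x) (G x)" "0 \<le> inner (x - G x) (K x)"
        using nonneg_selfadjoint_inner[OF R(1)] K by blast+
      then show ?thesis
        by (simp add: inner_diff inner_commute)
    qed
  qed
  moreover have "K \<circ> K = (\<lambda>x. G x - G (G x))"
    by (auto simp: K_sq)
  moreover have "positive_op (\<lambda>x. G x - G (G x))"
  proof (rule positive_opI)
    show "bounded_clinear (\<lambda>x. G x - G (G x))"
      by (intro bounded_clinear_diff bounded_clinear_compose[OF G_bc] G_bc)
    show "inner (G x - G (G x)) y = inner x (G y - G (G y))" for x y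
      by (simp add: inner_diff positive_op_sym[OF G])
    show "0 \<le> inner (G x - G (G x)) x" for x
      unfolding K_sq[symmetric] K_inner[of "K x"] by simp
  qed
  ultimately have K_sqrt: "sqrt_op (\<lambda>x. G x - G (G x)) = K"
    by (intro sqrt_op_eqI)
  show ?thesis
    unfolding K_sqrt
  proof
    assume "R y = Some z"
    then show "G z = K y"
      using K_eq[OF GR] by simp
  next
    assume GK: "G z = K y"
    \<comment> \<open>Evaluating \<open>R\<close> at \<open>K y = G z\<close> in two ways identifies
      \<open>y - G y\<close> with \<open>K z\<close>. Adding the values of \<open>R\<close> at
      \<open>K z\<close> and at \<open>G y\<close> then reassembles \<open>R y\<close>.\<close>
    have "R (K y) = Some (y - G y)"
      by (rule K(2))
    moreover have "R (K y) = Some (K z)"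
      using K(1)[of z] by (simp add: GK)
    ultimately have "y - G y = K z"
      by simp
    then have "R (y - G y) = Some (z - G z)"
      using K(2)[of z] by simp
    from linear_operator_add[OF R_lin this K(1)[of y]] show "R y = Some z"
      by (simp flip: GK)
  qed
qed

lemma sqrt_operator_unique:
  assumes X: "nonneg_selfadjoint X" and "nonneg_selfadjoint R" "R \<circ>\<^sub>m R = X"
    and "nonneg_selfadjoint R'" "R' \<circ>\<^sub>m R' = X"
  shows "R = R'"
proof -
  obtain G where G: "positive_op G" "\<And>y z. G z = y \<longleftrightarrow> X y = Some (z - y)"
    using resolvent_op_exists[OF X] by blast
  have "R y = Some z \<longleftrightarrow> R' y = Some z" for y z
    using sqrt_operator_graph[OF X _ _ G] assms by simp
  then show ?thesis
    by (intro ext) (metis not_Some_eq)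
qed

lemma sqrt_operator_eqI:
  assumes "nonneg_selfadjoint X" "nonneg_selfadjoint R" "R \<circ>\<^sub>m R = X"
  shows "sqrt_operator X = R"
  unfolding sqrt_operator_def using assms sqrt_operator_unique by (intro the_equality) blast+

lemma
  assumes "nonneg_selfadjoint X"
  shows nonneg_selfadjoint_sqrt_operator: "nonneg_selfadjoint (sqrt_operator X)"
    and sqrt_operator_sqrt_operator: "sqrt_operator X \<circ>\<^sub>m sqrt_operator X = X"
  using sqrt_operator_exists[OF assms] sqrt_operator_eqI[OF assms] by metis+

lemma nonneg_selfadjoint_Some: "nonneg_selfadjoint Some"
proof (rule nonneg_selfadjointI)
  have "linear_operator Some"
    by (rule linear_operatorI) simp_all
  then show "selfadjoint Some"
    unfolding selfadjoint_iff by (auto simp: dom_def intro: eq_if_inner_eq[symmetric])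
qed auto


section \<open>The generalized KYP inequality\<close>

text \<open>The inequality says that \<open>diag(R, I) T = T' diag(R, I)\<close> on \<open>dom R \<oplus> M\<close> for a contraction
  \<open>T'\<close>. The vector \<open>z\<close> is the first component of \<open>T'\<^sup>* (y, v)\<close>.\<close>

lemma kyp_dual:
  fixes T :: "'h::complex_hilbert_space \<times> 'm::complex_hilbert_space \<Rightarrow>
      'h \<times> 'n::complex_hilbert_space"
  assumes T: "bounded_clinear T" and R: "selfadjoint R"
    and invariant: "\<And>x x' u. R x = Some x' \<Longrightarrow> \<exists>k. R (fst (T (x, u))) = Some k"
    and dissipative: "\<And>x x' u k. R x = Some x' \<Longrightarrow> R (fst (T (x, u))) = Some k \<Longrightarrow>
      (norm k)\<^sup>2 + (norm (snd (T (x, u))))\<^sup>2 \<le> (norm x')\<^sup>2 + (norm u)\<^sup>2"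
    and y: "R y = Some y'"
  shows "\<exists>z. R z = Some (fst (cadjoint T (y', v))) \<and>
    (norm z)\<^sup>2 + (norm (snd (cadjoint T (y', v))))\<^sup>2 \<le> (norm y)\<^sup>2 + (norm v)\<^sup>2"
proof -
  note lin = selfadjoint_linear[OF R]
  note T_lin = bounded_clinear_linear[OF T]
  \<comment> \<open>The functional sends \<open>diag(R, I) (x, u)\<close> to
    \<open>inner (T (x, u)) (y', v)\<close>. As a graph it needs no prior check that the value
    depends on \<open>(x', u)\<close> alone.\<close>
  define W where "W = {((x', u), inner (T (x, u)) (y', v)) | x x' u. R x = Some x'}"
  have "subspace W"
    unfolding subspace_def
  proof (intro conjI ballI allI)
    have "((0, 0), inner (T (0, 0)) (y', v)) \<in> W"
      unfolding W_def using linear_operator_zero[OF lin] by blast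
    then show "0 \<in> W"
      using linear_0[OF T_lin] by (simp add: zero_prod_def)
    show "p + q \<in> W" if pq: "p \<in> W" "q \<in> W" for p q
    proof -
      obtain x x' u where p: "R x = Some x'" "p = ((x', u), inner (T (x, u)) (y', v))"
        using pq(1) by (auto simp: W_def)
      obtain a a' w where q: "R a = Some a'" "q = ((a', w), inner (T (a, w)) (y', v))"
        using pq(2) by (auto simp: W_def)
      have "T (x + a, u + w) = T (x, u) + T (a, w)"
        by (simp flip: linear_add[OF T_lin])
      then show ?thesis
        unfolding W_def using linear_operator_add[OF lin p(1) q(1)]
        by (intro CollectI exI[of _ "x + a"] exI[of _ "x' + a'"] exI[of _ "u + w"])
           (simp add: p q inner_add_left)
    qed
    show "r *\<^sub>R p \<in> W" if rp: "p \<in> W" for r p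
    proof -
      obtain x x' u where p: "R x = Some x'" "p = ((x', u), inner (T (x, u)) (y', v))"
        using rp by (auto simp: W_def)
      have "T (r *\<^sub>R x, r *\<^sub>R u) = r *\<^sub>R T (x, u)"
        by (simp flip: linear_scale[OF T_lin])
      then show ?thesis
        unfolding W_def using linear_operator_scaleR[OF lin p(1), of r]
        by (intro CollectI exI[of _ "r *\<^sub>R x"] exI[of _ "r *\<^sub>R x'"] exI[of _ "r *\<^sub>R u"])
           (simp add: p)
    qed
  qed
  moreover have "\<bar>t\<bar> \<le> norm (y, v) * norm l" if l: "(l, t) \<in> W" for l t
  proof -
    obtain x x' u where x: "R x = Some x'" "l = (x', u)" "t = inner (T (x, u)) (y', v)"
      using l by (auto simp: W_def)
    obtain k where k: "R (fst (T (x, u))) = Some k"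
      using invariant[OF x(1)] by blast
    \<comment> \<open>\<open>R\<close> is moved from \<open>y\<close> onto the new state, where the
      dissipation inequality controls it.\<close>
    have "t = inner (k, snd (T (x, u))) (y, v)"
      using selfadjoint_inner[OF R k y] by (simp add: x(3) inner_prod_def)
    then have "\<bar>t\<bar> \<le> norm (k, snd (T (x, u))) * norm (y, v)"
      by (simp only: Cauchy_Schwarz_ineq2)
    also have "\<dots> \<le> norm (x', u) * norm (y, v)"
      using dissipative[OF x(1) k] by (intro mult_right_mono) (simp_all add: norm_Pair)
    finally show ?thesis
      by (simp add: x(2) mult.commute)
  qed
  ultimately have "\<exists>q \<in> closure (fst ` W). norm q \<le> norm (y, v) \<and> (\<forall>(l, t) \<in> W. t = inner l q)"
    by (rule riesz_graph) simp_all
  then obtain z w where zw: "norm (z, w) \<le> norm (y, v)"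
    and W_repr: "\<And>l t. (l, t) \<in> W \<Longrightarrow> t = inner l (z, w)"
    by fastforce
  have repr: "inner x (fst (cadjoint T (y', v))) + inner u (snd (cadjoint T (y', v))) = inner x' z + inner u w"
    if "R x = Some x'" for x x' u
  proof -
    have "((x', u), inner (T (x, u)) (y', v)) \<in> W"
      unfolding W_def using that by blast
    then have "inner (T (x, u)) (y', v) = inner (x', u) (z, w)"
      by (rule W_repr)
    then show ?thesis
      unfolding inner_cadjoint[OF T] by (simp add: inner_prod_def)
  qed
  have "R z = Some (fst (cadjoint T (y', v)))"
    \<comment> \<open>\<open>u = 0\<close> places \<open>z\<close> in the domain of the adjoint of
      \<open>R\<close>, which is \<open>R\<close>; \<open>x = 0\<close> then identifies
      \<open>w\<close>.\<close>
    using repr[of _ _ 0] by (intro selfadjointD[OF R]) simp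
  moreover have "snd (cadjoint T (y', v)) = w"
    using repr[OF linear_operator_zero[OF lin]] by - (rule eq_if_inner_eq, simp)
  moreover have "(norm (z, w))\<^sup>2 \<le> (norm (y, v))\<^sup>2"
    using zw by (intro power_mono) simp_all
  ultimately show ?thesis
    by (intro exI[of _ z]) (simp add: norm_Pair)
qed

text \<open>Polarised, the isometry says that \<open>x'\<close> satisfies the adjoint relation with
  value \<open>x\<close>, so \<open>R x' = x\<close> and \<open>X\<close> is a restriction of the
  identity. A selfadjoint operator has no proper symmetric extension.\<close>

lemma isometric_sqrt_imp_identity:
  assumes X: "nonneg_selfadjoint X" and R: "nonneg_selfadjoint R" "R \<circ>\<^sub>m R = X"
    and iso: "\<And>x x'. R x = Some x' \<Longrightarrow> norm x' = norm x"
  shows "X = Some"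
proof -
  have sa: "selfadjoint R" "selfadjoint X"
    using R X by (simp_all add: nonneg_selfadjoint_def)
  note lin = selfadjoint_linear[OF sa(1)]
  have iso_inner: "inner x' y' = inner x y" if "R x = Some x'" "R y = Some y'" for x x' y y'
  proof -
    have "norm (x' + y') = norm (x + y)" "norm x' = norm x" "norm y' = norm y"
      using iso linear_operator_add[OF lin that] that by blast+
    then show ?thesis
      by (simp add: dot_norm)
  qed
  have X_eq: "X x = Some x" if "R x = Some x'" for x x'
  proof -
    have "R x' = Some x"
      using iso_inner that by (intro selfadjointD[OF sa(1)])
    then show ?thesis
      using that by (simp add: R(2)[symmetric] map_comp_eq_Some_iff)
  qed
  have X_sub: "z = y" if "X y = Some z" for y z
  proof -
    obtain y' where "R y = Some y'"
      using \<open>X y = Some z\<close> unfolding R(2)[symmetric] map_comp_eq_Some_iff by blast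
    then show ?thesis
      using X_eq \<open>X y = Some z\<close> by simp
  qed
  have "X y = Some y" for y
    using X_sub by (intro selfadjointD[OF sa(2)]) blast
  then show ?thesis
    by blast
qed

lemma diag_id_Some: "diag_id Some z = z"
  by (cases z) (simp add: diag_id_def)

lemma kyp_solution_identity:
  assumes "contraction (block_op A B C D)"
  shows "kyp_solution A B C D Some"
proof -
  have root: "sqrt_operator Some = Some"
    using nonneg_selfadjoint_Some by (intro sqrt_operator_eqI) (auto simp: map_comp_eq_Some_iff)
  show ?thesis
    unfolding kyp_solution_def positive_selfadjoint_def root diag_id_Some
    using nonneg_selfadjoint_Some contraction_norm_le[OF assms] by (auto intro: power_mono)
qed

theorem theorem7p11:
  fixes A :: "'h::separable_hilbert_space \<Rightarrow> 'h"
    and B :: "'m::separable_hilbert_space \<Rightarrow> 'h"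
    and C :: "'h \<Rightarrow> 'n::separable_hilbert_space"
    and D :: "'m \<Rightarrow> 'n"
    and T :: "'h \<times> 'm \<Rightarrow> 'h \<times> 'n"
  assumes "bounded_clinear A" and "bounded_clinear B"
    and "bounded_clinear C" and "bounded_clinear D"
    and "T = block_op A B C D"
    and "contraction T"
    and "shorted (defect_sq T) fst_space = (\<lambda>_. 0)"
    and "shorted (defect_sq (cadjoint T)) fst_space = (\<lambda>_. 0)"
    and "short_defect_range (snd_proj \<circ> T) \<inter> short_defect_range (snd_proj \<circ> cadjoint T) = {0}"
  shows "\<forall>X. kyp_solution A B C D X \<longleftrightarrow> X = Some"
proof (intro allI iffI)
  fix X :: "'h \<rightharpoonup> 'h"
  assume "X = Some"
  then show "kyp_solution A B C D X"
    using assms(5,6) kyp_solution_identity by simp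
next
  fix X :: "'h \<rightharpoonup> 'h"
  assume sol: "kyp_solution A B C D X"
  define R where "R = sqrt_operator X"
  have X: "nonneg_selfadjoint X" and inj_X: "{x. X x = Some 0} = {0}"
    using sol by (simp_all add: kyp_solution_def positive_selfadjoint_def)
  have R: "nonneg_selfadjoint R" "R \<circ>\<^sub>m R = X"
    unfolding R_def using X
    by (rule nonneg_selfadjoint_sqrt_operator, rule sqrt_operator_sqrt_operator)
  have sa: "selfadjoint R"
    using R(1) by (simp add: nonneg_selfadjoint_def)
  note lin = selfadjoint_linear[OF sa]
  \<comment> \<open>The kernel of \<open>R\<close> lies in that of \<open>X = R^2\<close>, which
    positivity makes trivial.\<close>
  have inj_R: "x = y" if "R x = Some z" "R y = Some z" for x y z
  proof -
    have "R (x - y) = Some 0"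
      using linear_operator_diff[OF lin that] by simp
    then have "X (x - y) = Some 0"
      using linear_operator_zero[OF lin] by (simp add: R(2)[symmetric] map_comp_eq_Some_iff)
    then show ?thesis
      using inj_X by (metis (mono_tags, lifting) eq_iff_diff_eq_0 mem_Collect_eq singletonD)
  qed
  have T_eq: "fst (T (x, u)) = A x + B u" for x u
    by (simp add: assms(5) block_op_def)
  have invariant: "\<exists>k. R (fst (T (x, u))) = Some k" if "R x = Some x'" for x x' u
  proof -
    have "A x \<in> dom R" "B u \<in> dom R"
      using sol that unfolding kyp_solution_def R_def by blast+
    then show ?thesis
      unfolding T_eq using linear_operator_add[OF lin] by blast
  qed
  have dissipative: "(norm k)\<^sup>2 + (norm (snd (T (x, u))))\<^sup>2 \<le> (norm x')\<^sup>2 + (norm u)\<^sup>2"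
    if "R x = Some x'" "R (fst (T (x, u))) = Some k" for x x' u k
  proof -
    have "(norm (diag_id R (x, u)))\<^sup>2 - (norm (diag_id R (T (x, u))))\<^sup>2 \<ge> 0"
      using sol that unfolding kyp_solution_def R_def assms(5) by blast
    then show ?thesis
      using that by (simp add: diag_id_def case_prod_unfold norm_Pair)
  qed
  have "norm x' = norm x" if Rx: "R x = Some x'" for x x'
  proof (rule antisym)
    have "(norm x)\<^sup>2 \<le> (norm (the (R x)))\<^sup>2"
    proof (rule storage_ge_norm_sq[OF assms(6,7,9), where K = "dom R" and \<phi> = "\<lambda>x. (norm (the (R x)))\<^sup>2"])
      show "fst (T (y, u)) \<in> dom R" if "y \<in> dom R" for y u
        using invariant that by blast
      show "(norm (the (R (fst (T (y, u))))))\<^sup>2 + (norm (snd (T (y, u))))\<^sup>2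
          \<le> (norm (the (R y)))\<^sup>2 + (norm u)\<^sup>2" if y: "y \<in> dom R" for y u
      proof -
        obtain y' where y': "R y = Some y'"
          using y by blast
        obtain k where k: "R (fst (T (y, u))) = Some k"
          using invariant[OF y'] by blast
        show ?thesis
          using dissipative[OF y' k] by (simp add: y' k)
      qed
    qed (use Rx in auto)
    then show "norm x \<le> norm x'"
      using Rx by (simp add: abs_le_square_iff[symmetric])
    \<comment> \<open>\<open>S\<close> is the inverse of \<open>R\<close>, meaningful only on
      \<open>ran R\<close>, which therefore becomes the set \<open>K\<close> for the adjoint
      system.\<close>
    define S where "S y' = (THE y. R y = Some y')" for y'
    have S: "S y' = y" if "R y = Some y'" for y y'
      unfolding S_def using that inj_R by blast
    have T': "contraction (cadjoint T)"
      using assms(6) by (rule contraction_cadjoint)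
    have TT: "cadjoint (cadjoint T) = T"
      using assms(6) by (intro cadjoint_cadjoint contraction_bounded_clinear)
    \<comment> \<open>The condition on the two ranges is symmetric in \<open>T\<close> and its
      adjoint, so the storage estimate applies to the adjoint as well.\<close>
    have ranges: "short_defect_range (snd_proj \<circ> cadjoint T) \<inter>
        short_defect_range (snd_proj \<circ> cadjoint (cadjoint T)) = {0}"
      using assms(9) by (simp add: TT Int_commute)
    have "(norm x')\<^sup>2 \<le> (norm (S x'))\<^sup>2"
    proof (rule storage_ge_norm_sq[OF T' assms(8) ranges, where K = "ran R" and \<phi> = "\<lambda>y. (norm (S y))\<^sup>2"])
      fix y' v
      assume "y' \<in> ran R"
      then obtain y where y: "R y = Some y'"
        by (auto simp: ran_def)
      have "\<exists>z. R z = Some (fst (cadjoint T (y', v))) \<and>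
          (norm z)\<^sup>2 + (norm (snd (cadjoint T (y', v))))\<^sup>2 \<le> (norm y)\<^sup>2 + (norm v)\<^sup>2"
        using contraction_bounded_clinear[OF assms(6)] sa
      proof (rule kyp_dual)
        show "\<exists>k. R (fst (T (x, u))) = Some k" if "R x = Some x'" for x x' u
          using that by (rule invariant)
        show "(norm k)\<^sup>2 + (norm (snd (T (x, u))))\<^sup>2 \<le> (norm x')\<^sup>2 + (norm u)\<^sup>2"
          if "R x = Some x'" "R (fst (T (x, u))) = Some k" for x x' u k
          using that by (rule dissipative)
      qed (rule y)
      then obtain z where z: "R z = Some (fst (cadjoint T (y', v)))"
        "(norm z)\<^sup>2 + (norm (snd (cadjoint T (y', v))))\<^sup>2 \<le> (norm y)\<^sup>2 + (norm v)\<^sup>2"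
        by blast
      show "fst (cadjoint T (y', v)) \<in> ran R"
        using z(1) by (rule ranI)
      show "(norm (S (fst (cadjoint T (y', v)))))\<^sup>2 + (norm (snd (cadjoint T (y', v))))\<^sup>2
          \<le> (norm (S y'))\<^sup>2 + (norm v)\<^sup>2"
        using z by (simp add: S[OF y] S[OF z(1)])
    qed (use Rx in \<open>auto intro: ranI\<close>)
    then show "norm x' \<le> norm x"
      using Rx S by (simp add: abs_le_square_iff[symmetric])
  qed
  then show "X = Some"
    by (rule isometric_sqrt_imp_identity[OF X R])
qed

end
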